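(* For $n\ge 0$ denote by $E_n$ the function field of the Drinfeld modular curve $X_0(T^{n+2})$ over $\mathbb{F}=\mathbb{F}_q(T)$. Then the tower of function fields $(E_n)_{n\ge 0}$ can be recursively given as follows: $E_0=\mathbb{F}(\xi_0)$ (a rational function field) and $E_{n+1}=E_n(\xi_{n+1})$ with $$(\xi_{n+1}+1)^{q-1}\cdot\xi_{n+1}=\frac{1}{T^{q-1}}\cdot\frac{\xi_n^q}{(\xi_n+1)^{q-1}}\qquad\text{for } n\ge 0.$$
   Context: $\mathbb{F}_q$ is a finite field and $\mathbb{F}=\mathbb{F}_q(T)$. For monic $N\in\mathbb{F}_q[T]$, $X_0(N)$ is the Drinfeld modular curve over $\mathbb{F}$ parametrizing pairs of rank two Drinfeld $\mathbb{F}_q[T]$-modules $(\phi,\phi')$ together with an $N$-isogeny $\phi\to\phi'$ (i.e. an isogeny with cyclic kernel isomorphic to $\mathbb{F}_q[T]/(N)$). Its function field is $\mathbb{F}(j_0,j_1(N))$, where $j_0$ (transcendental over $\mathbb{F}$) is the $j$-invariant of $\phi$ and $j_1(N)$ that of $\phi'$, related by $\Phi_N(j_0,j_1(N))=0$ with $\Phi_N$ the Drinfeld modular polynomial; the $j$-invariant of the Drinfeld module given by $\phi_T=\Delta\tau^2+g\tau+T$ is $g^{q+1}/\Delta$. The inclusions $E_n\subset E_{n+1}$ come from the natural projections $X_0(T^{n+3})\to X_0(T^{n+2})$ (factor a $T^{n+3}$-isogeny into a $T^{n+2}$-isogeny followed by a $T$-isogeny). *)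

theory Defs
  imports
    "HOL-Library.Cardinality"
    "HOL-Computational_Algebra.Computational_Algebra"
    "HOL-Algebra.Generated_Fields"
    "HOL-Algebra.Algebraic_Closure_Type"
begin

text \<open>
  Conventions.  The type \<open>'q\<close> is the finite field \<open>\<bbbF>\<^sub>q\<close>, so \<open>q = CARD('q)\<close>; \<open>'q poly\<close> is
  \<open>A = \<bbbF>\<^sub>q[T]\<close> and \<open>'q poly fract\<close> is \<open>F = \<bbbF>\<^sub>q(T)\<close>.  All algebraic objects live in an algebraically
  closed extension \<open>'k\<close> of \<open>F\<close>, given by a field embedding \<open>\<iota>\<close>; the base field inside \<open>'k\<close>
  is \<open>range \<iota>\<close>.
\<close>

abbreviation T_elem :: "'q::field poly" where
  "T_elem \<equiv> [:0, 1:]"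

definition base_embedding :: "('q::{field,finite} poly fract \<Rightarrow> 'k::field) \<Rightarrow> bool" where
  "base_embedding \<iota> \<longleftrightarrow> \<iota> \<in> ring_hom ring_of_type_algebra ring_of_type_algebra"

definition transcendental_over :: "('q::{field,finite} poly fract \<Rightarrow> 'k::field) \<Rightarrow> 'k \<Rightarrow> bool" where
  "transcendental_over \<iota> x \<longleftrightarrow> ring.transcendental ring_of_type_algebra (range \<iota>) x"

definition adjoin :: "'k::field set \<Rightarrow> 'k set \<Rightarrow> 'k set" where
  "adjoin K S = generate_field ring_of_type_algebra (K \<union> S)"

text \<open>
  The twisted polynomial ring \<open>'k{\<tau>}\<close>, with \<open>\<tau> c = c\<^sup>q \<tau>\<close>, is represented by the
  \<open>q\<close>-linearized polynomials: \<open>\<Sum> a\<^sub>i \<tau>\<^sup>i\<close> corresponds to \<open>\<Sum> a\<^sub>i X^(q^i)\<close>, and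
  multiplication in \<open>'k{\<tau>}\<close> corresponds to composition (\<^const>\<open>pcompose\<close>).
\<close>

definition linearized :: "nat \<Rightarrow> 'k::field poly \<Rightarrow> bool" where
  "linearized q p \<longleftrightarrow> (\<forall>i. poly.coeff p i \<noteq> 0 \<longrightarrow> (\<exists>k. i = q ^ k))"

text \<open>
  A rank two Drinfeld \<open>A\<close>-module over \<open>'k\<close>: an \<open>\<bbbF>\<^sub>q\<close>-algebra homomorphism \<open>\<phi> : A \<rightarrow> 'k{\<tau>}\<close>
  such that \<open>\<phi>\<^sub>a\<close> has constant term (the coefficient of \<open>\<tau>\<^sup>0\<close>, i.e. of \<open>X\<close>) equal to \<open>a\<close>, and
  \<open>\<phi>\<^sub>T = \<Delta>\<tau>\<^sup>2 + g\<tau> + T\<close> has \<open>\<tau>\<close>-degree exactly 2.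
\<close>

definition drinfeld_module_rank2 ::
  "('q::{field,finite} poly fract \<Rightarrow> 'k::field) \<Rightarrow> ('q poly \<Rightarrow> 'k poly) \<Rightarrow> bool" where
  "drinfeld_module_rank2 \<iota> \<phi> \<longleftrightarrow>
     (\<forall>a. linearized CARD('q) (\<phi> a)) \<and>
     (\<forall>a b. \<phi> (a + b) = \<phi> a + \<phi> b) \<and>
     (\<forall>a b. \<phi> (a * b) = pcompose (\<phi> a) (\<phi> b)) \<and>
     (\<forall>c. \<phi> [:c:] = [:0, \<iota> (to_fract [:c:]):]) \<and>
     (\<forall>a. poly.coeff (\<phi> a) 1 = \<iota> (to_fract a)) \<and>
     Polynomial.degree (\<phi> T_elem) = CARD('q) ^ 2"

definition drinfeld_g :: "('q::{field,finite} poly \<Rightarrow> 'k::field poly) \<Rightarrow> 'k" where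
  "drinfeld_g \<phi> = poly.coeff (\<phi> T_elem) CARD('q)"

definition drinfeld_Delta :: "('q::{field,finite} poly \<Rightarrow> 'k::field poly) \<Rightarrow> 'k" where
  "drinfeld_Delta \<phi> = poly.coeff (\<phi> T_elem) (CARD('q) ^ 2)"

definition j_invariant :: "('q::{field,finite} poly \<Rightarrow> 'k::field poly) \<Rightarrow> 'k" where
  "j_invariant \<phi> = drinfeld_g \<phi> ^ (CARD('q) + 1) / drinfeld_Delta \<phi>"

definition isogeny ::
  "('q::{field,finite} poly \<Rightarrow> 'k::field poly) \<Rightarrow> ('q poly \<Rightarrow> 'k poly) \<Rightarrow> 'k poly \<Rightarrow> bool" where
  "isogeny \<phi> \<phi>' u \<longleftrightarrow>
     u \<noteq> 0 \<and> linearized CARD('q) u \<and> (\<forall>a. pcompose u (\<phi> a) = pcompose (\<phi>' a) u)"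

text \<open>
  An \<open>N\<close>-isogeny is one whose kernel, an \<open>A\<close>-module via \<open>a \<cdot> x = \<phi>\<^sub>a(x)\<close>, is isomorphic to
  \<open>A/(N)\<close>: there is an \<open>A\<close>-linear map from \<open>A\<close> onto the kernel that vanishes exactly on the
  ideal \<open>(N)\<close>.  Over an algebraically closed field of generic characteristic an isogeny has nonzero
  derivative, so its kernel is determined by its roots.
\<close>

definition N_isogeny ::
  "'q::{field,finite} poly \<Rightarrow> ('q poly \<Rightarrow> 'k::field poly) \<Rightarrow> ('q poly \<Rightarrow> 'k poly) \<Rightarrow> 'k poly \<Rightarrow> bool" where
  "N_isogeny N \<phi> \<phi>' u \<longleftrightarrow>
     isogeny \<phi> \<phi>' u \<and>
     (\<exists>f. module_hom (*) (\<lambda>a x. poly (\<phi> a) x) f \<and>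
          range f = {x. poly u x = 0} \<and>
          {a. f a = 0} = {a. N dvd a})"

text \<open>
  The function field of \<open>X\<^sub>0(N)\<close>, realised inside \<open>'k\<close> by a generic point: it is
  \<open>F(j(\<phi>), j(\<phi>'))\<close> for an \<open>N\<close>-isogeny \<open>\<phi> \<rightarrow> \<phi>'\<close> with \<open>j(\<phi>)\<close> transcendental over \<open>F\<close>.
\<close>

definition X0_generic_point ::
  "('q::{field,finite} poly fract \<Rightarrow> 'k::field) \<Rightarrow> 'q poly \<Rightarrow>
   ('q poly \<Rightarrow> 'k poly) \<Rightarrow> ('q poly \<Rightarrow> 'k poly) \<Rightarrow> 'k poly \<Rightarrow> bool" where
  "X0_generic_point \<iota> N \<phi> \<phi>' u \<longleftrightarrow>
     drinfeld_module_rank2 \<iota> \<phi> \<and> drinfeld_module_rank2 \<iota> \<phi>' \<and>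
     N_isogeny N \<phi> \<phi>' u \<and> transcendental_over \<iota> (j_invariant \<phi>)"

definition X0_function_field ::
  "('q::{field,finite} poly fract \<Rightarrow> 'k::field) \<Rightarrow>
   ('q poly \<Rightarrow> 'k poly) \<Rightarrow> ('q poly \<Rightarrow> 'k poly) \<Rightarrow> 'k set" where
  "X0_function_field \<iota> \<phi> \<phi>' = adjoin (range \<iota>) {j_invariant \<phi>, j_invariant \<phi>'}"

end

theory Submission
  imports Defs
begin

text \<open>
  Factor the isogenies into a chain \<open>\<phi> = \<phi>\<^sub>0 \<rightarrow> \<phi>\<^sub>1 \<rightarrow> \<phi>\<^sub>2 \<rightarrow> \<dots>\<close> of \<open>T\<close>-isogenies, where \<open>\<phi>\<^sub>i \<rightarrow> \<phi>\<^sub>i\<^sub>+\<^sub>1\<close> has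
  kernel \<open>\<bbbF>\<^sub>q x\<^sub>i\<close>.  With \<open>s\<^sub>i = \<Delta>(\<phi>\<^sub>i) x\<^sub>i^(q\<^sup>2 - 1)\<close> one gets
  \<open>j(\<phi>\<^sub>i) = (s\<^sub>i + T)^(q + 1) / s\<^sub>i\<close> and \<open>j(\<phi>\<^sub>i\<^sub>+\<^sub>1) = (T\<^sup>q + s\<^sub>i)^(q + 1) / s\<^sub>i\<^sup>q\<close>.  Cyclicity gives a point
  \<open>z\<^sub>i\<close> with \<open>\<phi>\<^sub>i\<^sub>,\<^sub>T(z\<^sub>i) = x\<^sub>i\<close> whose image spans the next kernel; for \<open>c = z\<^sub>i / x\<^sub>i\<close> and \<open>w\<^sub>i = T(c\<^sup>q - c)\<close>
  this reads \<open>s\<^sub>i = T\<^sup>q (1 + w\<^sub>i) / w\<^sub>i\<^sup>q\<close> and \<open>s\<^sub>i\<^sub>+\<^sub>1 = T (1 + w\<^sub>i)\<^sup>q / w\<^sub>i\<close>.  Comparing the two expressions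
  for \<open>s\<^sub>i\<^sub>+\<^sub>1\<close> yields the recursion for \<open>\<xi>\<^sub>i = -(1 + w\<^sub>i) / w\<^sub>i\<close>.

  It remains to see that \<open>j\<^sub>0 = j(\<phi>)\<close> and \<open>J = j(\<phi>\<^sub>n\<^sub>+\<^sub>2)\<close> generate \<open>K = F(w\<^sub>0, \<dots>, w\<^sub>n)\<close>.  The relations show
  \<open>[K : F(j\<^sub>0)] \<le> (q + 1) q^(n + 1)\<close>.  In a valuation ring in which \<open>w\<^sub>0\<close> is not a unit, all \<open>w\<^sub>i\<close> are
  nonunits, \<open>1/J\<close> is \<open>w\<^sub>n\<close> up to a unit and \<open>1/j\<^sub>0\<close> is \<open>w\<^sub>n^(q^(n + 2))\<close> up to a unit.  Hence
  \<open>[F(j\<^sub>0, J) : F(j\<^sub>0)] \<ge> q^(n + 2)\<close>, which is more than half of the upper bound, so \<open>F(j\<^sub>0, J) = K\<close>.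
\<close>

section \<open>Subfields and simple extensions\<close>

locale subring_set =
  fixes K :: "'a::comm_ring_1 set"
  assumes one_mem: "1 \<in> K"
    and add_mem: "x \<in> K \<Longrightarrow> y \<in> K \<Longrightarrow> x + y \<in> K"
    and uminus_mem: "x \<in> K \<Longrightarrow> - x \<in> K"
    and mult_mem: "x \<in> K \<Longrightarrow> y \<in> K \<Longrightarrow> x * y \<in> K"
begin

lemma zero_mem: "0 \<in> K"
  using add_mem[OF one_mem uminus_mem[OF one_mem]] by simp

lemma diff_mem: "x \<in> K \<Longrightarrow> y \<in> K \<Longrightarrow> x - y \<in> K"
  using add_mem[of x "- y"] uminus_mem by simp

lemma power_mem: "x \<in> K \<Longrightarrow> x ^ n \<in> K"
  by (induction n) (auto intro: one_mem mult_mem)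

lemma sum_mem: "(\<And>i. i \<in> A \<Longrightarrow> f i \<in> K) \<Longrightarrow> sum f A \<in> K"
  by (induction A rule: infinite_finite_induct) (auto intro: zero_mem add_mem)

lemma poly_mem: "(\<And>i. poly.coeff p i \<in> K) \<Longrightarrow> x \<in> K \<Longrightarrow> poly p x \<in> K"
  unfolding poly_altdef by (intro sum_mem mult_mem power_mem) auto

end

locale subfield_set = subring_set K for K :: "'a::field set" +
  assumes inverse_mem: "x \<in> K \<Longrightarrow> inverse x \<in> K"
begin

lemma divide_mem: "x \<in> K \<Longrightarrow> y \<in> K \<Longrightarrow> x / y \<in> K"
  unfolding divide_inverse by (intro mult_mem inverse_mem)

lemmas mem_intros = zero_mem one_mem add_mem uminus_mem mult_mem diff_mem power_mem
  inverse_mem divide_mem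

end

section \<open>Polynomials with coefficients in a subring\<close>

definition poly_over :: "'a::comm_ring_1 set \<Rightarrow> 'a poly set" where
  "poly_over K = {p. \<forall>i. poly.coeff p i \<in> K}"

context subring_set
begin

lemma poly_over_pCons_iff [simp]: "pCons a p \<in> poly_over K \<longleftrightarrow> a \<in> K \<and> p \<in> poly_over K"
  unfolding poly_over_def by (auto simp: coeff_pCons split: nat.splits)

lemma poly_over_0 [simp]: "0 \<in> poly_over K"
  by (simp add: poly_over_def zero_mem)

lemma poly_over_1 [simp]: "1 \<in> poly_over K"
  by (simp add: one_pCons one_mem)

lemma poly_over_add: "p \<in> poly_over K \<Longrightarrow> r \<in> poly_over K \<Longrightarrow> p + r \<in> poly_over K"
  by (simp add: poly_over_def add_mem)

lemma poly_over_uminus: "p \<in> poly_over K \<Longrightarrow> - p \<in> poly_over K"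
  by (simp add: poly_over_def uminus_mem)

lemma poly_over_diff: "p \<in> poly_over K \<Longrightarrow> r \<in> poly_over K \<Longrightarrow> p - r \<in> poly_over K"
  by (simp add: poly_over_def diff_mem)

lemma poly_over_smult: "c \<in> K \<Longrightarrow> p \<in> poly_over K \<Longrightarrow> Polynomial.smult c p \<in> poly_over K"
  by (simp add: poly_over_def mult_mem)

lemma poly_over_mult: "p \<in> poly_over K \<Longrightarrow> r \<in> poly_over K \<Longrightarrow> p * r \<in> poly_over K"
  by (auto simp: poly_over_def coeff_mult intro!: sum_mem mult_mem)

lemma poly_over_power: "p \<in> poly_over K \<Longrightarrow> p ^ n \<in> poly_over K"
  by (induction n) (auto intro: poly_over_mult)

lemma poly_over_monom: "c \<in> K \<Longrightarrow> Polynomial.monom c n \<in> poly_over K"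
  by (simp add: poly_over_def zero_mem)

lemmas poly_over_intros = poly_over_0 poly_over_1 poly_over_add poly_over_uminus poly_over_diff
  poly_over_smult poly_over_mult poly_over_power poly_over_monom

end

section \<open>Translation between fields as types and rings with carriers\<close>

abbreviation (input) type_ring :: "'a::field ring" where
  "type_ring \<equiv> ring_of_type_algebra"

lemma type_ring_simps [simp]:
  "carrier (type_ring :: 'a::field ring) = UNIV"
  "monoid.mult (type_ring :: 'a::field ring) = (*)"
  "monoid.one (type_ring :: 'a::field ring) = 1"
  "ring.zero (type_ring :: 'a::field ring) = 0"
  "ring.add (type_ring :: 'a::field ring) = (+)"
  by (auto simp: ring_of_type_algebra_def fun_eq_iff)

lemma type_ring_a_inv [simp]: "\<ominus>\<^bsub>type_ring\<^esub> x = - (x :: 'a::field)"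
proof -
  interpret R: field "type_ring :: 'a ring" by (rule field_from_type_algebra)
  show ?thesis using R.minus_equality[of "- x" x] by simp
qed

lemma type_ring_m_inv: "x \<noteq> 0 \<Longrightarrow> inv\<^bsub>type_ring\<^esub> x = inverse (x :: 'a::field)"
proof -
  assume "x \<noteq> 0"
  interpret R: field "type_ring :: 'a ring" by (rule field_from_type_algebra)
  show ?thesis using R.inv_unique'[of x "inverse x"] \<open>x \<noteq> 0\<close> by simp
qed

lemma type_ring_pow [simp]: "x [^]\<^bsub>type_ring\<^esub> (n::nat) = (x :: 'a::field) ^ n"
  by (induction n) (simp_all add: nat_pow_def)

lemma subfield_type_ring_iff: "subfield K (type_ring :: 'a::field ring) \<longleftrightarrow> subfield_set K"
proof -
  interpret R: field "type_ring :: 'a ring" by (rule field_from_type_algebra)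
  show ?thesis
  proof
    assume K: "subfield K (type_ring :: 'a ring)"
    note E = subringE[OF subfieldE(1)[OF K], simplified]
    show "subfield_set K"
    proof
      fix x assume "x \<in> K"
      thus "inverse x \<in> K"
        using R.subfield_m_inv(1)[OF K, of x] E(2) by (cases "x = 0") (auto simp: type_ring_m_inv)
    qed (use E in auto)
  next
    assume "subfield_set K"
    then interpret K: subfield_set K .
    show "subfield K (type_ring :: 'a ring)"
      by (rule R.subfieldI'[OF R.subringI])
        (auto intro: K.mem_intros simp: type_ring_m_inv)
  qed
qed

lemma subfield_set_adjoin: "subfield_set (adjoin K S)"
proof -
  interpret R: field "type_ring :: 'a ring" by (rule field_from_type_algebra)
  show ?thesis unfolding adjoin_def subfield_type_ring_iff[symmetric]
    by (rule R.generate_field_is_subfield) simp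
qed

lemma adjoin_incl: "K \<union> S \<subseteq> adjoin K S"
  unfolding adjoin_def by (auto intro: generate_field.incl)

lemma adjoin_least:
  assumes "subfield_set L" "K \<union> S \<subseteq> L"
  shows "adjoin K S \<subseteq> L"
proof -
  interpret R: field "type_ring :: 'a ring" by (rule field_from_type_algebra)
  show ?thesis unfolding adjoin_def
    by (rule R.generate_field_min_subfield1) (use assms in \<open>auto simp: subfield_type_ring_iff\<close>)
qed

text \<open>Elements of \<open>K [X]\<close> are coefficient lists with the leading coefficient
  first, whereas \<open>Poly\<close> starts from the constant term; hence \<open>rev\<close> here
  and below.\<close>

lemma eval_type_ring:
  "ring.eval type_ring xs (x :: 'a::field) = poly (Poly (rev xs)) x"
proof -
  interpret R: field "type_ring :: 'a ring" by (rule field_from_type_algebra)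
  show ?thesis
    by (induction xs) (auto simp: Poly_snoc poly_monom)
qed

lemma carrier_poly_type_ring:
  "carrier (K [X]\<^bsub>type_ring\<^esub>) = {xs :: 'a::field list. xs = [] \<or> (set xs \<subseteq> K \<and> hd xs \<noteq> 0)}"
  by (auto simp: univ_poly_def polynomial_def)

lemma rev_coeffs_in_carrier:
  assumes "p \<in> poly_over K"
  shows "rev (coeffs p) \<in> carrier (K [X]\<^bsub>type_ring\<^esub>)"
  using assms
  by (auto simp: carrier_poly_type_ring hd_rev last_coeffs_eq_coeff_degree coeffs_def poly_over_def
      split: if_splits)

lemma transcendental_type_ring_iff:
  assumes "subfield_set (K :: 'a::field set)"
  shows "ring.transcendental type_ring K x \<longleftrightarrow> (\<forall>p \<in> poly_over K. poly p x = 0 \<longrightarrow> p = 0)"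
proof -
  interpret R: field "type_ring :: 'a ring" by (rule field_from_type_algebra)
  interpret K: subfield_set K by fact
  show ?thesis
  proof (intro iffI ballI impI)
    fix p assume *: "ring.transcendental type_ring K x" "p \<in> poly_over K" "poly p x = 0"
    have "rev (coeffs p) = []"
      by (rule R.eval_transcendental[of K x])
        (use * rev_coeffs_in_carrier in \<open>auto simp: over_def eval_type_ring\<close>)
    thus "p = 0" by simp
  next
    assume *: "\<forall>p \<in> poly_over K. poly p x = 0 \<longrightarrow> p = 0"
    show "ring.transcendental type_ring K x"
    proof (rule ccontr)
      assume "R.algebraic K x"
      then obtain xs where xs: "xs \<in> carrier (K [X]\<^bsub>type_ring\<^esub>)" "xs \<noteq> []" "R.eval xs x = 0"
        using R.algebraicE[of K x] assms
        by (auto simp: over_def subfield_type_ring_iff[symmetric] dest: subfieldE(1))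
      have "Poly (rev xs) \<in> poly_over K"
        using xs by (auto simp: poly_over_def carrier_poly_type_ring nth_default_def rev_nth
            intro!: K.zero_mem)
      moreover have "poly.coeff (Poly (rev xs)) (length xs - 1) = hd xs"
        using xs(2) by (auto simp: nth_default_def rev_nth hd_conv_nth)
      moreover have "poly (Poly (rev xs)) x = 0" "hd xs \<noteq> 0"
        using xs by (simp_all add: eval_type_ring carrier_poly_type_ring)
      ultimately show False
        using * by (metis coeff_0)
    qed
  qed
qed

lemma simple_extension_root:
  assumes "subfield_set (K :: 'a::field set)" "p \<in> poly_over K" "p \<noteq> 0" "poly p x = 0"
  shows "subfield_set (ring.simple_extension type_ring K x)"
    and "\<exists>m \<le> Polynomial.degree p. ring.dimension type_ring m K (ring.simple_extension type_ring K x)"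
proof -
  interpret R: field "type_ring :: 'a ring" by (rule field_from_type_algebra)
  have K: "subfield K type_ring" using assms by (simp add: subfield_type_ring_iff)
  have alg: "(R.algebraic over K) x"
    using transcendental_type_ring_iff[OF assms(1)] assms unfolding over_def by auto
  show "subfield_set (R.simple_extension K x)"
    using R.simple_extension_is_subfield[OF K] alg by (simp add: subfield_type_ring_iff)
  have p: "rev (coeffs p) \<in> carrier (K [X]\<^bsub>type_ring\<^esub>)"
    using rev_coeffs_in_carrier assms by blast
  have "R.Irr K x pdivides\<^bsub>type_ring\<^esub> rev (coeffs p)"
    by (rule R.Irr_minimal[OF K _ alg p]) (simp_all add: eval_type_ring assms)
  hence "length (R.Irr K x) - 1 \<le> length (rev (coeffs p)) - 1"
    using R.pdivides_imp_degree_le[OF subfieldE(1)[OF K] R.IrrE(1)[OF K _ alg] p] assms by simp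
  thus "\<exists>m \<le> Polynomial.degree p. R.dimension m K (R.simple_extension K x)"
    using R.dimension_simple_extension[OF K _ alg] assms by (auto simp: length_coeffs)
qed

text \<open>The dimension is the degree of the minimal polynomial, which is itself a nonzero
  relation for \<open>x\<close>. Valuations will later exclude relations of small degree.\<close>

lemma dimension_simple_extension_ge:
  assumes "subfield_set (K :: 'a::field set)"
    and "\<exists>p \<in> poly_over K. p \<noteq> 0 \<and> poly p x = 0"
    and "\<And>p. p \<in> poly_over K \<Longrightarrow> poly p x = 0 \<Longrightarrow> Polynomial.degree p < N \<Longrightarrow> p = 0"
  shows "\<exists>m \<ge> N. ring.dimension type_ring m K (ring.simple_extension type_ring K x)"
proof -
  interpret R: field "type_ring :: 'a ring" by (rule field_from_type_algebra)
  interpret K: subfield_set K by fact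
  have K: "subfield K type_ring" using assms by (simp add: subfield_type_ring_iff)
  have alg: "(R.algebraic over K) x"
    using transcendental_type_ring_iff[OF assms(1)] assms unfolding over_def by auto
  define xs where "xs = R.Irr K x"
  have xs: "xs \<in> carrier (K [X]\<^bsub>type_ring\<^esub>)" "R.eval xs x = 0" "hd xs = 1"
    using R.IrrE[OF K _ alg] by (auto simp: xs_def)
  have ne: "xs \<noteq> []"
    using R.IrrE(2)[OF K _ alg] R.pirreducibleE(1)[OF subfieldE(1)[OF K] xs(1)] by (auto simp: xs_def)
  have 1: "Poly (rev xs) \<in> poly_over K"
    using xs by (auto simp: poly_over_def carrier_poly_type_ring nth_default_def rev_nth
        intro!: K.zero_mem)
  have 2: "poly.coeff (Poly (rev xs)) (length xs - 1) = hd xs"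
    using ne by (auto simp: nth_default_def rev_nth hd_conv_nth)
  have 3: "Polynomial.degree (Poly (rev xs)) \<le> length xs - 1"
    by (rule degree_le) (auto simp: nth_default_def)
  have "Poly (rev xs) \<noteq> 0"
    using 2 xs(3) by (metis coeff_0 zero_neq_one)
  hence "N \<le> length xs - 1"
    using assms(3)[OF 1] xs(2) 3 by (force simp: eval_type_ring)
  thus ?thesis
    using R.dimension_simple_extension[OF K _ alg] by (auto simp: xs_def)
qed

section \<open>Valuation rings\<close>

definition ring_adjoin :: "'a::comm_ring_1 set \<Rightarrow> 'a \<Rightarrow> 'a set" where
  "ring_adjoin B x = (\<lambda>p. poly p x) ` poly_over B"

context subring_set
begin

lemma subring_set_ring_adjoin: "subring_set (ring_adjoin K x)"
proof
  show "1 \<in> ring_adjoin K x"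
    unfolding ring_adjoin_def by (rule image_eqI[of _ _ 1]) auto
  fix a b assume "a \<in> ring_adjoin K x" "b \<in> ring_adjoin K x"
  then obtain p r where "p \<in> poly_over K" "r \<in> poly_over K" "a = poly p x" "b = poly r x"
    by (auto simp: ring_adjoin_def)
  then show "a + b \<in> ring_adjoin K x" "a * b \<in> ring_adjoin K x" "- a \<in> ring_adjoin K x"
    unfolding ring_adjoin_def
    by (intro image_eqI[of _ _ "p + r"] image_eqI[of _ _ "p * r"] image_eqI[of _ _ "- p"]
        poly_over_intros; simp)+
qed

lemma ring_adjoin_incl: "K \<subseteq> ring_adjoin K x" "x \<in> ring_adjoin K x"
proof -
  show "K \<subseteq> ring_adjoin K x"
    unfolding ring_adjoin_def by (auto intro!: image_eqI[of _ _ "[:_:]"])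
  show "x \<in> ring_adjoin K x"
    unfolding ring_adjoin_def by (auto intro!: image_eqI[of _ _ "[:0, 1:]"] zero_mem one_mem)
qed

end

section \<open>Existence of valuation rings by Chevalley's argument\<close>

locale valuation_ring = subring_set V for V :: "'a::field set" +
  assumes mem_or_inverse_mem: "x \<in> V \<or> inverse x \<in> V"

text \<open>The situation that Zorn's lemma produces in \<open>exists_valuation_ring\<close>.
  Maximality forces such a ring to be a valuation ring in which \<open>t\<close> is not
  invertible.\<close>

locale maximal_subring_excluding = subring_set B for B :: "'a::field set" and t +
  assumes t_mem: "t \<in> B" and inverse_t: "inverse t \<notin> B" and t_nonzero: "t \<noteq> 0"
    and maximal: "\<And>C. subring_set C \<Longrightarrow> B \<subseteq> C \<Longrightarrow> inverse t \<notin> C \<Longrightarrow> C = B"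
begin

lemma t_mult_neq_1: "b \<in> B \<Longrightarrow> t * b \<noteq> 1"
  using inverse_t inverse_unique[of t b] by auto

text \<open>By maximality the strictly larger ring \<open>B[x]\<close> contains
  \<open>inverse t\<close>, which is therefore a polynomial value at \<open>x\<close>.\<close>

lemma relation_of_not_mem:
  assumes "x \<notin> B"
  obtains p where "p \<in> poly_over B" "t * poly p x = 1"
proof -
  have "inverse t \<in> ring_adjoin B x"
    using maximal[OF subring_set_ring_adjoin ring_adjoin_incl(1)] ring_adjoin_incl(2) assms by metis
  thus ?thesis using that t_nonzero by (auto simp: ring_adjoin_def) (metis right_inverse)
qed

text \<open>Put \<open>s = 1 - t * b\<close>. If \<open>inverse s\<close> were missing, clearing
  denominators in its relation would put a power of \<open>s\<close> into \<open>t B\<close>; but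
  every power of \<open>s\<close> is 1 modulo \<open>t B\<close>, so 1 would lie in
  \<open>t B\<close>.\<close>

lemma inverse_one_minus_mem:
  assumes "b \<in> B"
  shows "inverse (1 - t * b) \<in> B"
proof (rule ccontr)
  define s where "s = 1 - t * b"
  assume "inverse (1 - t * b) \<notin> B"
  then obtain p where p: "p \<in> poly_over B" "t * poly p (inverse s) = 1"
    unfolding s_def using relation_of_not_mem by blast
  have s: "s \<in> B" "s \<noteq> 0"
    using assms t_mult_neq_1[OF assms] by (auto simp: s_def intro: diff_mem one_mem mult_mem t_mem)
  define k where "k = Polynomial.degree p"
  define b' where "b' = (\<Sum>i\<le>k. poly.coeff p i * s ^ (k - i))"
  have "s ^ k * poly p (inverse s) = (\<Sum>i\<le>k. poly.coeff p i * (s ^ k * inverse s ^ i))"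
    by (simp add: poly_altdef sum_distrib_left k_def mult_ac)
  also have "\<dots> = b'"
    unfolding b'_def using s by (intro sum.cong) (auto simp: power_diff field_simps)
  finally have 1: "s ^ k = t * b'"
    using p(2) by (metis mult.left_commute mult.right_neutral)
  have b': "b' \<in> B"
    unfolding b'_def using p s by (intro sum_mem mult_mem power_mem) (auto simp: poly_over_def)
  have "\<exists>c\<in>B. s ^ n = 1 - t * c" for n
  proof (induction n)
    case 0
    show ?case by (rule bexI[of _ 0]) (auto intro: zero_mem)
  next
    case (Suc n)
    then obtain c where "c \<in> B" "s ^ n = 1 - t * c" by auto
    moreover have "(1 - t * b) * (1 - t * c) = 1 - t * (b + c - t * b * c)"
      by (simp add: algebra_simps)
    ultimately show ?case
      by (intro bexI[of _ "b + c - t * b * c"])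
        (auto simp: s_def intro!: add_mem diff_mem mult_mem t_mem assms)
  qed
  then obtain c where "c \<in> B" "s ^ k = 1 - t * c" by blast
  hence "t * (b' + c) = 1" using 1 by (simp add: algebra_simps)
  thus False using t_mult_neq_1 add_mem b' \<open>c \<in> B\<close> by blast
qed

text \<open>Chevalley's descent: a relation for \<open>inverse z\<close> removes the leading term of one for \<open>z\<close>.\<close>

lemma lower_degree_relation:
  assumes p: "p \<in> poly_over B" "Polynomial.degree p \<le> Suc n" "t * poly p z = 1"
    and r: "r \<in> poly_over B" "Polynomial.degree r \<le> Suc n" "t * poly r (inverse z) = 1"
    and z: "z \<noteq> 0"
  shows "\<exists>p'\<in>poly_over B. Polynomial.degree p' \<le> n \<and> t * poly p' z = 1"
proof -
  \<comment> \<open>\<open>u\<close> is 1 modulo \<open>t B\<close>, hence a unit of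
    \<open>B\<close>.\<close>
  define u where "u = 1 - t * poly.coeff r 0"
  have coeffs: "poly.coeff p i \<in> B" "poly.coeff r i \<in> B" for i
    using p r by (auto simp: poly_over_def)
  have u: "inverse u \<in> B" "u \<noteq> 0"
    using inverse_one_minus_mem t_mult_neq_1 coeffs unfolding u_def by auto
  define a where "a = poly.coeff p (Suc n)"
  \<comment> \<open>\<open>h\<close> is \<open>z ^ Suc n\<close> times the part of \<open>r\<close>
    at \<open>inverse z\<close> without its constant term, so the relation for
    \<open>inverse z\<close> becomes \<open>u * z ^ Suc n = t * h(z)\<close>, where \<open>h\<close>
    has degree at most \<open>n\<close>.\<close>
  define h where "h = (\<Sum>j=1..Suc n. Polynomial.monom (poly.coeff r j) (Suc n - j))"
  define c where "c = a * (t * inverse u)"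
  define p' where "p' = p - Polynomial.monom a (Suc n) + Polynomial.smult c h"
  have "(\<Sum>i\<le>Suc n. poly.coeff r i * inverse z ^ i) = poly r (inverse z)"
    unfolding poly_altdef using r(2) by (intro sum.mono_neutral_right) (auto simp: coeff_eq_0)
  hence "poly r (inverse z) = poly.coeff r 0 + (\<Sum>j=1..Suc n. poly.coeff r j * inverse z ^ j)"
  proof -
    have "{..Suc n} = insert 0 {1..Suc n}" by auto
    thus ?thesis using \<open>(\<Sum>i\<le>Suc n. _ i) = _\<close> by simp
  qed
  hence "u = t * (\<Sum>j=1..Suc n. poly.coeff r j * inverse z ^ j)"
    using r(3) by (simp add: u_def algebra_simps)
  hence "u * z ^ Suc n = t * (\<Sum>j=1..Suc n. poly.coeff r j * (z ^ Suc n * inverse z ^ j))"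
    by (simp only: sum_distrib_left mult_ac)
  also have "(\<Sum>j=1..Suc n. poly.coeff r j * (z ^ Suc n * inverse z ^ j)) = poly h z"
    unfolding h_def poly_sum poly_monom using z
    by (intro sum.cong refl arg_cong2[where f = "(*)"])
      (auto simp: power_diff field_simps simp del: power_Suc)
  finally have "z ^ Suc n = t * inverse u * poly h z"
    using u by (simp add: field_simps del: power_Suc)
  hence "poly p' z = poly p z"
    by (simp add: p'_def c_def poly_monom mult_ac del: power_Suc)
  moreover have "p' \<in> poly_over B"
  proof -
    have "h \<in> poly_over B"
      unfolding h_def poly_over_def by (auto simp: coeff_sum intro!: sum_mem coeffs zero_mem)
    thus ?thesis
      unfolding p'_def c_def a_def
      by (intro poly_over_intros p(1) mult_mem coeffs u t_mem)
  qed
  moreover have "Polynomial.degree p' \<le> n"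
  proof -
    have "Polynomial.degree (p - Polynomial.monom a (Suc n)) \<le> n"
      using p(2) by (intro degree_le) (auto simp: a_def coeff_eq_0)
    moreover have "Polynomial.degree h \<le> n"
      unfolding h_def by (intro degree_sum_le) (auto intro!: order.trans[OF degree_monom_le])
    ultimately show ?thesis
      unfolding p'_def by (intro degree_add_le order.trans[OF degree_smult_le])
  qed
  ultimately show ?thesis using p(3) by auto
qed

text \<open>If neither \<open>x\<close> nor \<open>inverse x\<close> were in \<open>B\<close>, both
  would have relations; choose them of least degree. The one of smaller degree lowers the degree of
  the other, a contradiction.\<close>

lemma valuation_ring: "valuation_ring B"
proof
  fix x
  show "x \<in> B \<or> inverse x \<in> B"
  proof (rule ccontr)
    define P where "P = (\<lambda>z n. \<exists>p\<in>poly_over B. Polynomial.degree p \<le> n \<and> t * poly p z = 1)"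
    assume *: "\<not> ?thesis"
    have not0: "\<not> P z 0" for z
    proof
      assume "P z 0"
      then obtain p where "p \<in> poly_over B" "Polynomial.degree p = 0" "t * poly p z = 1"
        by (auto simp: P_def)
      thus False
        using t_mult_neq_1 by (auto elim!: degree_eq_zeroE)
    qed
    have ex: "\<exists>n. P x n" "\<exists>n. P (inverse x) n"
      using relation_of_not_mem * unfolding P_def by (metis order.refl)+
    have x: "x \<noteq> 0" using * zero_mem by auto
    define n m where "n = (LEAST n. P x n)" and "m = (LEAST n. P (inverse x) n)"
    have nm: "P x n" "P (inverse x) m"
      unfolding n_def m_def using ex by (auto intro: LeastI_ex)
    have descend: False
      if "P z k" "P (inverse z) l" "l \<le> k" "z \<noteq> 0" "\<And>i. i < k \<Longrightarrow> \<not> P z i" for z k l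
    proof (cases k)
      case 0
      thus ?thesis using that not0 by auto
    next
      case (Suc k')
      have "P z k'"
        using that(1,2,3,4) lower_degree_relation[of _ k' z] Suc unfolding P_def
        by (meson order.trans)
      thus ?thesis using that(5)[of k'] Suc by auto
    qed
    show False
    proof (cases "m \<le> n")
      case True
      thus ?thesis using descend[of x n m] nm x not_less_Least n_def by blast
    next
      case False
      thus ?thesis
        using descend[of "inverse x" m n] nm x not_less_Least[of _ "P (inverse x)"]
        unfolding m_def[symmetric] by auto
    qed
  qed
qed

end

text \<open>Zorn's lemma applies to the subrings that contain \<open>F[t]\<close> but not
  \<open>inverse t\<close>. The family is nonempty because \<open>inverse t = p(t)\<close> would
  make \<open>X p - 1\<close> a relation for the transcendental \<open>t\<close>.\<close>

lemma exists_valuation_ring: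
  fixes F :: "'a::field set"
  assumes "subfield_set F" and trans: "\<And>p. p \<in> poly_over F \<Longrightarrow> poly p t = 0 \<Longrightarrow> p = 0"
  obtains V where "valuation_ring V" "F \<subseteq> V" "inverse t \<notin> V" "t \<noteq> 0"
proof -
  interpret F: subfield_set F by fact
  define A where "A = {C. subring_set C \<and> ring_adjoin F t \<subseteq> C \<and> inverse t \<notin> C}"
  have t: "t \<noteq> 0" using trans[of "[:0, 1:]"] by (auto simp: F.zero_mem F.one_mem)
  have "inverse t \<notin> ring_adjoin F t"
  proof
    assume "inverse t \<in> ring_adjoin F t"
    then obtain p where p: "p \<in> poly_over F" "inverse t = poly p t" by (auto simp: ring_adjoin_def)
    have "pCons (- 1) p = 0"
      by (rule trans) (use p t in \<open>auto simp: F.uminus_mem F.one_mem p(2)[symmetric]\<close>)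
    thus False by simp
  qed
  hence "ring_adjoin F t \<in> A"
    using F.subring_set_ring_adjoin by (auto simp: A_def)
  hence "\<exists>M\<in>A. \<forall>C\<in>A. M \<subseteq> C \<longrightarrow> C = M"
  proof (intro subset_Zorn_nonempty)
    fix \<C> assume ne: "\<C> \<noteq> {}" and chain: "subset.chain A \<C>"
    have sub: "subring_set C" "ring_adjoin F t \<subseteq> C" "inverse t \<notin> C" if "C \<in> \<C>" for C
      using that chain by (auto simp: subset.chain_def A_def)
    have "subring_set (\<Union>\<C>)"
    proof
      show "1 \<in> \<Union>\<C>" using ne sub(1) subring_set.one_mem by blast
      fix x y assume "x \<in> \<Union>\<C>" "y \<in> \<Union>\<C>"
      then obtain C D where CD: "C \<in> \<C>" "x \<in> C" "D \<in> \<C>" "y \<in> D" by auto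
      hence "C \<subseteq> D \<or> D \<subseteq> C" using chain by (auto simp: subset.chain_def)
      then obtain M where "M \<in> \<C>" "x \<in> M" "y \<in> M" using CD by auto
      then show "x + y \<in> \<Union>\<C>" "x * y \<in> \<Union>\<C>" "- x \<in> \<Union>\<C>"
        using sub(1)[of M] subring_set.add_mem subring_set.mult_mem subring_set.uminus_mem by blast+
    qed
    thus "\<Union>\<C> \<in> A" using sub ne by (fastforce simp: A_def)
  qed auto
  then obtain M where M: "M \<in> A" and max: "\<And>C. C \<in> A \<Longrightarrow> M \<subseteq> C \<Longrightarrow> C = M" by blast
  interpret M: subring_set M using M by (simp add: A_def)
  interpret maximal_subring_excluding M t
  proof
    show "t \<in> M" "inverse t \<notin> M" using M F.ring_adjoin_incl by (auto simp: A_def)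
    show "C = M" if "subring_set C" "M \<subseteq> C" "inverse t \<notin> C" for C
      using max[of C] M that by (auto simp: A_def)
  qed (fact t)
  show ?thesis
    using that[OF valuation_ring _ inverse_t t] M F.ring_adjoin_incl by (auto simp: A_def)
qed

section \<open>Units, nonunits and sums of terms with distinct valuations\<close>

context valuation_ring
begin

definition unit :: "'a \<Rightarrow> bool" where
  "unit x \<longleftrightarrow> x \<noteq> 0 \<and> x \<in> V \<and> inverse x \<in> V"

text \<open>This is the maximal ideal: membership in \<open>V\<close> follows
  (\<open>nonunit_mem\<close>). Zero is listed separately because \<open>inverse 0 = 0\<close> lies
  in \<open>V\<close>.\<close>

definition nonunit :: "'a \<Rightarrow> bool" where
  "nonunit x \<longleftrightarrow> x = 0 \<or> inverse x \<notin> V"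

lemma nonunit_mem: "nonunit x \<Longrightarrow> x \<in> V"
  using mem_or_inverse_mem[of x] zero_mem by (auto simp: nonunit_def)

lemma unit_iff: "unit x \<longleftrightarrow> x \<in> V \<and> \<not> nonunit x"
  by (auto simp: unit_def nonunit_def)

lemma unit_1: "unit 1"
  by (auto simp: unit_def one_mem)

lemma unit_mult: "unit x \<Longrightarrow> unit y \<Longrightarrow> unit (x * y)"
  by (auto simp: unit_def intro: mult_mem)

lemma unit_inverse: "unit x \<Longrightarrow> unit (inverse x)"
  by (auto simp: unit_def)

lemma unit_divide: "unit x \<Longrightarrow> unit y \<Longrightarrow> unit (x / y)"
  unfolding divide_inverse by (intro unit_mult unit_inverse)

lemma unit_power: "unit x \<Longrightarrow> unit (x ^ n)"
  by (induction n) (auto intro: unit_mult unit_1)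

lemma unit_power_int: "unit x \<Longrightarrow> unit (x powi n)"
  by (auto simp: power_int_def intro: unit_power unit_inverse)

lemma nonunit_mult:
  assumes "nonunit x" "y \<in> V"
  shows "nonunit (x * y)"
proof (rule ccontr)
  assume *: "\<not> nonunit (x * y)"
  hence "y * inverse (x * y) \<in> V" using assms by (auto simp: nonunit_def intro: mult_mem)
  also have "y * inverse (x * y) = inverse x" using * by (auto simp: nonunit_def)
  finally show False using assms(1) * by (auto simp: nonunit_def)
qed

lemma nonunit_power: "nonunit x \<Longrightarrow> n > 0 \<Longrightarrow> nonunit (x ^ n)"
  by (cases n) (auto intro!: nonunit_mult power_mem intro: nonunit_mem)

lemma nonunit_of_power:
  assumes "nonunit (x ^ n)" "n > 0"
  shows "nonunit x"
proof (rule ccontr)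
  assume "\<not> nonunit x"
  hence "x \<noteq> 0" "inverse (x ^ n) \<in> V"
    by (auto simp: nonunit_def power_inverse[symmetric] intro: power_mem)
  thus False using assms by (auto simp: nonunit_def)
qed

text \<open>One of \<open>x / y\<close> and \<open>y / x\<close> lies in \<open>V\<close>, so the
  sum is a nonunit times an element of \<open>V\<close>.\<close>

lemma nonunit_add:
  assumes "nonunit x" "nonunit y"
  shows "nonunit (x + y)"
proof -
  have *: "nonunit (a + b)" if "nonunit a" "nonunit b" "a / b \<in> V" "b \<noteq> 0" for a b
  proof -
    have "a + b = b * (1 + a / b)" using that by (simp add: field_simps)
    thus ?thesis using that by (auto intro!: nonunit_mult add_mem one_mem)
  qed
  show ?thesis
  proof (cases "x = 0 \<or> y = 0")
    case False
    have "x / y \<in> V \<or> y / x \<in> V" using mem_or_inverse_mem[of "x / y"] by simp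
    thus ?thesis using *[of x y] *[of y x] assms False by (auto simp: add.commute)
  qed (use assms in auto)
qed

lemma nonunit_sum: "(\<And>i. i \<in> A \<Longrightarrow> nonunit (f i)) \<Longrightarrow> nonunit (sum f A)"
  by (induction A rule: infinite_finite_induct) (auto intro: nonunit_add simp: nonunit_def[of 0])

lemma unit_add_nonunit:
  assumes "unit x" "nonunit y"
  shows "unit (x + y)"
proof -
  have "\<not> nonunit (x + y)"
  proof
    assume "nonunit (x + y)"
    moreover have "nonunit (y * (- 1))"
      using assms by (intro nonunit_mult uminus_mem one_mem)
    ultimately have "nonunit ((x + y) + y * (- 1))" by (rule nonunit_add)
    thus False using assms by (simp add: unit_iff)
  qed
  thus ?thesis using assms by (auto simp: unit_iff intro: add_mem nonunit_mem)
qed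

text \<open>After the term of least exponent is factored out, what remains is a unit plus nonunits,
  hence a unit.\<close>

lemma sum_distinct_valuations_nonzero:
  fixes e :: "'i \<Rightarrow> int"
  assumes "finite A" "A \<noteq> {}" "inj_on e A" "\<And>a. a \<in> A \<Longrightarrow> unit (u a)" "nonunit t" "t \<noteq> 0"
  shows "(\<Sum>a\<in>A. t powi e a * u a) \<noteq> 0"
proof -
  obtain b where b: "b \<in> A" "\<And>a. a \<in> A \<Longrightarrow> e b \<le> e a"
    using assms(1,2) by (metis arg_min_if_finite(1) arg_min_least)
  define r where "r = (\<Sum>a\<in>A - {b}. t powi (e a - e b) * u a)"
  have "nonunit r"
    unfolding r_def
  proof (intro nonunit_sum nonunit_mult)
    fix a assume a: "a \<in> A - {b}"
    hence "e b < e a" using b assms(3) by (metis DiffE inj_onD insertI1 order_le_imp_less_or_eq)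
    thus "nonunit (t powi (e a - e b))"
      using assms(5) by (auto simp: power_int_def intro!: nonunit_power)
    show "u a \<in> V" using assms(4) a by (auto simp: unit_def)
  qed
  hence "unit (u b + r)" using assms(4) b by (intro unit_add_nonunit)
  moreover have "(\<Sum>a\<in>A. t powi e a * u a) = t powi e b * (u b + r)"
    using assms b unfolding r_def
    by (subst sum.remove[OF assms(1) b(1)])
      (simp add: distrib_left sum_distrib_left power_int_diff mult.assoc[symmetric])
  ultimately show ?thesis using assms by (simp add: unit_def)
qed

text \<open>Nonzero elements of \<open>F\<close> are units of \<open>V\<close>. So a nonzero
  constant coefficient makes the value a unit, and otherwise a factor \<open>\<pi>\<close> splits
  off.\<close>

lemma poly_nonunit_decomp:
  assumes "subfield_set F" "F \<subseteq> V" "nonunit \<pi>" "p \<in> poly_over F" "poly p \<pi> \<noteq> 0"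
  shows "\<exists>(n::nat) u. unit u \<and> poly p \<pi> = \<pi> ^ n * u"
  using assms(4,5)
proof (induction p)
  case (pCons a p)
  interpret F: subfield_set F by fact
  show ?case
  proof (cases "a = 0")
    case True
    with pCons obtain n u where "unit u" "poly p \<pi> = \<pi> ^ n * u" by auto
    thus ?thesis using True by (intro exI[of _ "Suc n"] exI[of _ u]) auto
  next
    case False
    have "unit a" using False pCons.prems assms(2) F.inverse_mem by (auto simp: unit_def)
    moreover have "nonunit (\<pi> * poly p \<pi>)"
      using pCons.prems assms(2,3) nonunit_mem
      by (intro nonunit_mult poly_mem) (auto simp: poly_over_def coeff_pCons split: nat.splits)
    ultimately have "unit (poly (pCons a p) \<pi>)" by (auto intro: unit_add_nonunit)
    thus ?thesis by (intro exI[of _ 0] exI[of _ "poly (pCons a p) \<pi>"]) auto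
  qed
qed auto

text \<open>On \<open>F(\<pi>)\<close> the valuation takes only multiples of that of
  \<open>\<pi>\<close>: the elements are quotients of polynomial values at \<open>\<pi>\<close>, and
  both parts decompose. The generator is written \<open>inverse \<pi>\<close> because it will be a
  \<open>j\<close>-invariant with a pole.\<close>

lemma adjoin_nonunit_decomp:
  assumes F: "subfield_set F" "F \<subseteq> V" and \<pi>: "nonunit \<pi>" "\<pi> \<noteq> 0"
    and x: "x \<in> adjoin F {inverse \<pi>}" "x \<noteq> 0"
  shows "\<exists>(e::int) u. unit u \<and> x = \<pi> powi e * u"
proof -
  interpret F: subfield_set F by fact
  define Q where "Q = {poly f \<pi> / poly g \<pi> | f g. f \<in> poly_over F \<and> g \<in> poly_over F \<and> poly g \<pi> \<noteq> 0}"
  have QI: "y \<in> Q" if "f \<in> poly_over F" "g \<in> poly_over F" "poly g \<pi> \<noteq> 0" "y = poly f \<pi> / poly g \<pi>"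
    for y f g using that by (auto simp: Q_def)
  have QE: "\<exists>f g. f \<in> poly_over F \<and> g \<in> poly_over F \<and> poly g \<pi> \<noteq> 0 \<and> y = poly f \<pi> / poly g \<pi>"
    if "y \<in> Q" for y using that by (auto simp: Q_def)
  have "subfield_set Q"
  proof
    show "1 \<in> Q" by (rule QI[of 1 1]) auto
    fix a b assume "a \<in> Q" "b \<in> Q"
    then obtain f g f' g' where *: "f \<in> poly_over F" "g \<in> poly_over F" "poly g \<pi> \<noteq> 0"
        "a = poly f \<pi> / poly g \<pi>" "f' \<in> poly_over F" "g' \<in> poly_over F" "poly g' \<pi> \<noteq> 0"
        "b = poly f' \<pi> / poly g' \<pi>"
      using QE by metis
    show "a + b \<in> Q"
      by (rule QI[of "f * g' + f' * g" "g * g'"]) (use * in \<open>auto simp: add_frac_eq F.poly_over_intros\<close>)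
    show "a * b \<in> Q"
      by (rule QI[of "f * f'" "g * g'"]) (use * in \<open>auto simp: F.poly_over_intros\<close>)
    show "- a \<in> Q"
      by (rule QI[of "- f" g]) (use * in \<open>auto simp: F.poly_over_intros\<close>)
    show "inverse a \<in> Q"
    proof (cases "a = 0")
      case True
      thus ?thesis by (intro QI[of 0 1]) auto
    next
      case False
      thus ?thesis by (intro QI[of g f]) (use * in \<open>auto simp: F.poly_over_intros\<close>)
    qed
  qed
  moreover have "F \<union> {inverse \<pi>} \<subseteq> Q"
  proof -
    have "c \<in> Q" if "c \<in> F" for c
      by (rule QI[of "[:c:]" 1]) (use that in auto)
    moreover have "inverse \<pi> \<in> Q"
      by (rule QI[of 1 "[:0, 1:]"]) (use \<pi> in \<open>auto simp: F.zero_mem F.one_mem field_simps\<close>)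
    ultimately show ?thesis by auto
  qed
  ultimately have "x \<in> Q" using adjoin_least x by blast
  then obtain f g where fg: "f \<in> poly_over F" "g \<in> poly_over F" "poly g \<pi> \<noteq> 0"
      "x = poly f \<pi> / poly g \<pi>" using QE by blast
  obtain n u where 1: "unit u" "poly f \<pi> = \<pi> ^ n * u"
    using poly_nonunit_decomp[OF F \<pi>(1) fg(1)] x(2) fg by auto
  obtain m v where 2: "unit v" "poly g \<pi> = \<pi> ^ m * v"
    using poly_nonunit_decomp[OF F \<pi>(1) fg(2)] fg by auto
  show ?thesis
    using 1 2 fg(4) \<pi>(2)
    by (intro exI[of _ "int n - int m"] exI[of _ "u / v"])
      (auto simp: power_int_diff intro: unit_divide)
qed

text \<open>The powers \<open>y\<^sup>i\<close> with \<open>i < N\<close> have valuations in distinct classes modulo the value group of \<open>F(x)\<close>.\<close>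

lemma totally_ramified_no_relation:
  assumes F: "subfield_set F" "F \<subseteq> V" and t: "nonunit t" "t \<noteq> 0"
    and a: "unit a" "inverse x = t ^ N * a" and b: "unit b" "inverse y = t * b" and N: "N > 0"
    and p: "p \<in> poly_over (adjoin F {x})" "Polynomial.degree p < N" "poly p y = 0"
  shows "p = 0"
proof (rule ccontr)
  assume "p \<noteq> 0"
  define A where "A = {i. i \<le> Polynomial.degree p \<and> poly.coeff p i \<noteq> 0}"
  define \<pi> where "\<pi> = inverse x"
  have \<pi>: "nonunit \<pi>" "\<pi> \<noteq> 0"
    using t N a(1) unfolding \<pi>_def a(2) by (auto simp: unit_def intro!: nonunit_mult nonunit_power)
  have "\<exists>e u. unit u \<and> poly.coeff p i = \<pi> powi e * u" if "i \<in> A" for i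
    using that p(1) by (intro adjoin_nonunit_decomp[OF F \<pi>(1,2)]) (auto simp: A_def poly_over_def \<pi>_def)
  then obtain e u where eu: "\<And>i. i \<in> A \<Longrightarrow> unit (u i)"
      "\<And>i. i \<in> A \<Longrightarrow> poly.coeff p i = \<pi> powi e i * u i"
    by metis
  have y: "y = inverse (t * b)" using b by (metis inverse_inverse_eq)
  \<comment> \<open>Since \<open>\<pi> = t ^ N * a\<close> and \<open>y = inverse (t * b)\<close>,
    the term with index \<open>i\<close> is \<open>t powi e' i\<close> times the unit
    \<open>u' i\<close>, and \<open>e' i\<close> is congruent to \<open>- i\<close> modulo
    \<open>N\<close>.\<close>
  define e' where "e' = (\<lambda>i. int N * e i - int i)"
  define u' where "u' = (\<lambda>i. a powi e i * u i * inverse b ^ i)"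
  have "poly p y = (\<Sum>i\<in>A. poly.coeff p i * y ^ i)"
    unfolding poly_altdef A_def by (rule sum.mono_neutral_right) auto
  also have "\<dots> = (\<Sum>i\<in>A. t powi e' i * u' i)"
  proof (rule sum.cong[OF refl])
    fix i assume i: "i \<in> A"
    have "\<pi> powi e i = t powi (int N * e i) * a powi e i"
      using a by (simp add: \<pi>_def power_int_mult_distrib power_int_mult)
    moreover have "y ^ i = inverse b ^ i * t powi (- int i)"
      by (simp add: y power_mult_distrib power_int_minus power_inverse)
    moreover have "t powi e' i = t powi (int N * e i) * t powi (- int i)"
      using t by (simp add: e'_def power_int_add[symmetric])
    ultimately show "poly.coeff p i * y ^ i = t powi e' i * u' i"
      using eu(2)[OF i] by (simp add: u'_def mult_ac)
  qed
  finally have "(\<Sum>i\<in>A. t powi e' i * u' i) = 0" using p by simp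
  moreover have "(\<Sum>i\<in>A. t powi e' i * u' i) \<noteq> 0"
  proof (rule sum_distinct_valuations_nonzero[OF _ _ _ _ t])
    show "finite A" "A \<noteq> {}"
      using \<open>p \<noteq> 0\<close> by (auto simp: A_def intro!: exI[of _ "Polynomial.degree p"])
    show "inj_on e' A"
    proof (rule inj_onI)
      fix i j assume *: "i \<in> A" "j \<in> A" "e' i = e' j"
      hence "int i = int j + int N * (e i - e j)" by (simp add: e'_def algebra_simps)
      hence "int i mod int N = int j mod int N" by simp
      moreover have "i < N" "j < N" using * p(2) by (auto simp: A_def)
      ultimately show "i = j" by simp
    qed
    show "unit (u' i)" if "i \<in> A" for i
      using eu(1)[OF that] a b unfolding u'_def
      by (intro unit_mult unit_power_int unit_power unit_inverse)
  qed
  ultimately show False by contradiction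
qed

end

section \<open>The tower of function fields\<close>

text \<open>For \<open>x\<close> in \<open>K\<close> outside \<open>L\<close>, the elements
  \<open>x\<close> and 1 are independent over \<open>L\<close>, so \<open>[L(x) : K0]\<close> is at
  least \<open>2 * d\<close> and cannot fit into \<open>K\<close>.\<close>

lemma dimension_lower_bound_imp_eq:
  fixes K0 L K :: "'a::field set"
  defines "R \<equiv> type_ring :: 'a ring"
  assumes "subfield_set K0" "subfield_set L" "subfield_set K" "K0 \<subseteq> L" "L \<subseteq> K"
    and d: "ring.dimension R d K0 L" and e: "ring.dimension R e K0 K" and "e < 2 * d"
  shows "L = K"
proof (rule ccontr)
  interpret R: field R unfolding R_def by (rule field_from_type_algebra)
  interpret L: subfield_set L by fact
  have sub: "subfield K0 R" "subfield L R" "subfield K R"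
    using assms by (simp_all add: subfield_type_ring_iff)
  assume "L \<noteq> K"
  then obtain x where x: "x \<in> K" "x \<notin> L" using assms by blast
  have "(R.algebraic over K0) x"
    using R.finite_dimension_imp_algebraic[OF sub(1) subfieldE(1)[OF sub(3)] R.finite_dimensionI[OF e] x(1)] .
  hence alg: "(R.algebraic over L) x"
    using R.algebraic_mono[OF \<open>K0 \<subseteq> L\<close>] by blast
  define M where "M = R.simple_extension L x"
  have xR: "x \<in> carrier R" by (simp add: R_def)
  have M: "L \<subseteq> M" "x \<in> M" "M \<subseteq> K"
    unfolding M_def
    using R.simple_extension_incl[of L x] R.simple_extension_mem[OF subfieldE(1)[OF sub(2)] xR]
      R.simple_extension_subring_incl[OF subfieldE(1)[OF sub(3)] \<open>L \<subseteq> K\<close> x(1)] xR sub(2)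
    by (auto simp: R_def)
  define m where "m = length (R.Irr L x) - 1"
  have m: "R.dimension m L M"
    unfolding m_def M_def by (rule R.dimension_simple_extension[OF sub(2) xR alg])
  have "R.independent L [x, 1]"
  proof (intro R.li_Cons R.li_Nil)
    show "x \<notin> R.Span L [1]"
      using x by (auto simp: R.line_extension_mem_iff) (simp add: R_def)
    show "1 \<notin> R.Span L []" by auto (simp add: R_def)
  qed (simp_all add: R_def)
  hence "2 \<le> m"
    using R.independent_length_le_dimension[OF sub(2) m, of "[x, 1]"] M L.one_mem by auto
  have dm: "R.dimension (d * m) K0 M"
    by (rule R.telescopic_base[OF sub(1,2) d m])
  then obtain Vs where Vs: "R.independent K0 Vs" "length Vs = d * m" "R.Span K0 Vs = M"
    using R.exists_base[OF sub(1)] by blast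
  hence "set Vs \<subseteq> K"
    using R.Span_base_incl[OF sub(1), of Vs] M(3) by (auto simp: R_def)
  hence "d * m \<le> e"
    using R.independent_length_le_dimension[OF sub(1) e Vs(1)] Vs(2) by simp
  thus False using \<open>e < 2 * d\<close> mult_le_mono2[OF \<open>2 \<le> m\<close>, of d] by simp
qed

lemma simple_extension_eq_adjoin:
  assumes "subfield_set (K :: 'a::field set)" "subfield_set (ring.simple_extension type_ring K x)"
  shows "ring.simple_extension type_ring K x = adjoin K {x}"
proof
  interpret R: field "type_ring :: 'a ring" by (rule field_from_type_algebra)
  show "R.simple_extension K x \<subseteq> adjoin K {x}"
    by (rule R.simple_extension_subring_incl)
      (use subfield_set_adjoin[of K "{x}"] adjoin_incl[of K "{x}"] in
        \<open>auto simp: subfield_type_ring_iff[symmetric] dest: subfieldE(1)\<close>)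
  have "subfield K type_ring" using assms by (simp add: subfield_type_ring_iff)
  hence "K \<union> {x} \<subseteq> R.simple_extension K x"
    using R.simple_extension_incl[of K x] R.simple_extension_mem[OF subfieldE(1)] by auto
  thus "adjoin K {x} \<subseteq> R.simple_extension K x"
    by (rule adjoin_least[OF assms(2)])
qed

text \<open>If \<open>y\<close> were algebraic over \<open>F\<close>, then \<open>F(y)\<close> would
  be an algebraic extension and \<open>x\<close> would be algebraic too.\<close>

lemma transcendental_of_mem_adjoin:
  assumes F: "subfield_set (F :: 'a::field set)"
    and x: "\<And>p. p \<in> poly_over F \<Longrightarrow> poly p x = 0 \<Longrightarrow> p = 0" "x \<in> adjoin F {y}"
    and p: "p \<in> poly_over F" "poly p y = 0"
  shows "p = 0"
proof (rule ccontr)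
  assume "p \<noteq> 0"
  interpret R: field "type_ring :: 'a ring" by (rule field_from_type_algebra)
  have sF: "subfield F type_ring" using F by (simp add: subfield_type_ring_iff)
  have L: "subfield_set (R.simple_extension F y)"
    using simple_extension_root[OF F p(1) \<open>p \<noteq> 0\<close> p(2)] by simp
  have "x \<in> R.simple_extension F y"
    using x(2) simple_extension_eq_adjoin[OF F L] by simp
  moreover have "(R.algebraic over F) y"
    using transcendental_type_ring_iff[OF F] p \<open>p \<noteq> 0\<close> by (auto simp: over_def)
  ultimately have "(R.algebraic over F) x"
    using R.simple_extesion_mem_imp_algebraic[OF sF] by simp
  thus False
    using transcendental_type_ring_iff[OF F] x(1) by (auto simp: over_def)
qed

text \<open>Degrees multiply along \<open>K0\<close>, \<open>K\<close>, \<open>K(x)\<close>. Only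
  upper bounds are carried along, as the polynomials used for the tower are not shown to be
  irreducible.\<close>

lemma adjoin_root_dimension:
  assumes "subfield_set (K0 :: 'a::field set)" "subfield_set K"
    and "ring.dimension type_ring d K0 K" "d \<le> D"
    and "p \<in> poly_over K" "p \<noteq> 0" "poly p x = 0" "Polynomial.degree p \<le> k"
  shows "\<exists>d' \<le> D * k. ring.dimension type_ring d' K0 (adjoin K {x})"
proof -
  interpret R: field "type_ring :: 'a ring" by (rule field_from_type_algebra)
  obtain m where m: "m \<le> Polynomial.degree p" "R.dimension m K (R.simple_extension K x)"
    using simple_extension_root[OF assms(2,5-7)] by blast
  have "R.dimension (d * m) K0 (R.simple_extension K x)"
    by (rule R.telescopic_base[OF _ _ assms(3) m(2)]) (use assms in \<open>auto simp: subfield_type_ring_iff\<close>)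
  moreover have "R.simple_extension K x = adjoin K {x}"
    by (rule simple_extension_eq_adjoin[OF assms(2) simple_extension_root(1)[OF assms(2,5-7)]])
  moreover have "d * m \<le> D * k" using m assms by (intro mult_le_mono) auto
  ultimately show ?thesis by auto
qed

text \<open>The tower freed from Drinfeld modules. \<open>rel\<close> equates the two expressions
  \<open>T ^ q * (1 + w (Suc i)) / w (Suc i) ^ q\<close> and \<open>T * (1 + w i) ^ q / w i\<close>
  for the same parameter.\<close>

locale drinfeld_tower =
  fixes F :: "'a::field set" and q :: nat and T :: 'a and w :: "nat \<Rightarrow> 'a"
  assumes F: "subfield_set F" and T: "T \<in> F" "T \<noteq> 0" and q: "q \<ge> 2"
    and w: "w i \<noteq> 0" "1 + w i \<noteq> 0"
    and rel: "T ^ (q - 1) * (1 + w (Suc i)) * w i = (1 + w i) ^ q * w (Suc i) ^ q"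
begin

text \<open>Indices are shifted: \<open>s n\<close> belongs to step \<open>n + 1\<close> of the
  chain, so \<open>j n\<close> is the \<open>j\<close>-invariant of its module number
  \<open>n + 2\<close>.\<close>

definition "s0 = T ^ q * (1 + w 0) / w 0 ^ q"
definition "j0 = (s0 + T) ^ (q + 1) / s0"
definition "s n = T * (1 + w n) ^ q / w n"
definition "j n = (T ^ q + s n) ^ (q + 1) / s n ^ q"

sublocale F: subfield_set F by (rule F)

lemma nonzero: "s0 \<noteq> 0" "s n \<noteq> 0"
  using T w by (auto simp: s0_def s_def)

text \<open>\<open>K 0\<close> is just \<open>F(w 0)\<close> (see \<open>K_0\<close>). Passing
  through \<open>j0\<close> and \<open>s0\<close> lets the degree over \<open>F(j0)\<close> be
  bounded one generator at a time.\<close>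

primrec K :: "nat \<Rightarrow> 'a set" where
  "K 0 = adjoin (adjoin (adjoin F {j0}) {s0}) {w 0}"
| "K (Suc n) = adjoin (K n) {w (Suc n)}"

lemma subfield_set_K: "subfield_set (K n)"
  by (cases n) (auto intro: subfield_set_adjoin)

lemma F_subset: "F \<subseteq> adjoin F {j0}" "adjoin F {j0} \<subseteq> K n" and j0_mem: "j0 \<in> adjoin F {j0}"
  and w_mem: "w n \<in> K n"
proof -
  have 0: "adjoin F {j0} \<subseteq> K 0"
    using adjoin_incl[of "adjoin F {j0}" "{s0}"] adjoin_incl[of "adjoin (adjoin F {j0}) {s0}" "{w 0}"]
    by auto
  show "adjoin F {j0} \<subseteq> K n"
    using 0
  proof (induction n)
    case (Suc n)
    thus ?case using adjoin_incl[of "K n" "{w (Suc n)}"] by auto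
  qed
  show "F \<subseteq> adjoin F {j0}" "j0 \<in> adjoin F {j0}"
    using adjoin_incl[of F "{j0}"] by auto
  show "w n \<in> K n"
    using adjoin_incl[of _ "{w n}"] by (cases n) auto
qed

text \<open>\<open>s0\<close> is a root of \<open>(X + T) ^ (q + 1) - j0 * X\<close>,
  \<open>w 0\<close> a root of \<open>s0 * X ^ q - T ^ q * (X + 1)\<close>, and \<open>rel\<close>
  is an equation of degree \<open>q\<close> for \<open>w (Suc n)\<close> over
  \<open>K n\<close>.\<close>

lemma dimension_K: "\<exists>d \<le> (q + 1) * q ^ (n + 1). ring.dimension type_ring d (adjoin F {j0}) (K n)"
proof (induction n)
  case 0
  interpret R: field "type_ring :: 'a ring" by (rule field_from_type_algebra)
  interpret K0: subfield_set "adjoin F {j0}" by (rule subfield_set_adjoin)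
  interpret K1: subfield_set "adjoin (adjoin F {j0}) {s0}" by (rule subfield_set_adjoin)
  have T0: "T \<in> adjoin F {j0}" using F_subset T by auto
  have T1: "T \<in> adjoin (adjoin F {j0}) {s0}" using T0 adjoin_incl by auto
  have s1: "s0 \<in> adjoin (adjoin F {j0}) {s0}" using adjoin_incl by auto
  define p where "p = [:T, 1:] ^ (q + 1) - [:0, j0:]"
  have deg: "Polynomial.degree ([:T, 1:] ^ (q + 1)) = q + 1"
    by (subst degree_power_eq) auto
  have "poly.coeff ([:T, 1:] ^ (q + 1)) (q + 1) = 1"
    using lead_coeff_power[of "[:T, 1:]" "q + 1"] unfolding deg by simp
  hence "poly.coeff p (q + 1) = 1"
    unfolding p_def using q by (simp add: coeff_pCons split: nat.splits)
  hence "p \<noteq> 0" by auto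
  moreover have "Polynomial.degree p \<le> q + 1"
    unfolding p_def using deg q by (intro degree_diff_le) auto
  moreover have "poly p s0 = 0"
    using nonzero by (simp add: p_def j0_def add.commute distrib_right)
  moreover have "p \<in> poly_over (adjoin F {j0})"
    unfolding p_def
    by (intro K0.poly_over_intros) (auto simp: T0 K0.one_mem K0.zero_mem j0_mem)
  ultimately have "\<exists>d \<le> 1 * (q + 1). R.dimension d (adjoin F {j0}) (adjoin (adjoin F {j0}) {s0})"
    by (intro adjoin_root_dimension[where p = p] subfield_set_adjoin R.dimension_one)
      (auto simp: subfield_type_ring_iff subfield_set_adjoin)
  then obtain d where d: "d \<le> q + 1" "R.dimension d (adjoin F {j0}) (adjoin (adjoin F {j0}) {s0})"
    by auto
  define r where "r = Polynomial.monom s0 q - [:T ^ q, T ^ q:]"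
  have "poly.coeff r q = s0"
    using q by (simp add: r_def coeff_pCons split: nat.splits)
  hence "r \<noteq> 0" using nonzero by auto
  moreover have "Polynomial.degree r \<le> q"
    using q unfolding r_def
    by (intro degree_diff_le degree_monom_le) auto
  moreover have "poly r (w 0) = 0"
    using w by (simp add: r_def poly_monom s0_def distrib_left)
  moreover have "r \<in> poly_over (adjoin (adjoin F {j0}) {s0})"
    unfolding r_def
    by (intro K1.poly_over_intros) (auto simp: T1 s1 K1.zero_mem intro: K1.power_mem K1.poly_over_intros)
  ultimately show ?case
    using adjoin_root_dimension[OF subfield_set_adjoin subfield_set_adjoin d(2,1), of r "w 0" q]
    by simp
next
  case (Suc n)
  interpret K: subfield_set "K n" by (rule subfield_set_K)
  have TK: "T \<in> K n" using F_subset T by blast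
  obtain d where d: "d \<le> (q + 1) * q ^ (n + 1)" "ring.dimension type_ring d (adjoin F {j0}) (K n)"
    using Suc.IH by blast
  define c where "c = T ^ (q - 1) * w n"
  define r where "r = Polynomial.monom ((1 + w n) ^ q) q - [:c, c:]"
  have "poly.coeff r q = (1 + w n) ^ q"
    using q by (simp add: r_def coeff_pCons split: nat.splits)
  hence "r \<noteq> 0" using w by auto
  moreover have "Polynomial.degree r \<le> q"
    using q unfolding r_def
    by (intro degree_diff_le degree_monom_le) auto
  moreover have "poly r (w (Suc n)) = 0"
    using rel[of n] by (simp add: r_def c_def poly_monom algebra_simps)
  moreover have "r \<in> poly_over (K n)"
    unfolding r_def c_def
    by (intro K.poly_over_intros)
      (auto intro!: K.mem_intros TK w_mem)
  ultimately show ?case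
    using adjoin_root_dimension[OF subfield_set_adjoin subfield_set_K d(2,1), of r "w (Suc n)" q]
    by (simp add: mult_ac)
qed

lemma s0_j0_mem: "subfield_set L \<Longrightarrow> F \<subseteq> L \<Longrightarrow> w 0 \<in> L \<Longrightarrow> s0 \<in> L \<and> j0 \<in> L"
proof -
  assume "subfield_set L" "F \<subseteq> L" "w 0 \<in> L"
  then interpret L: subfield_set L by simp
  have "T \<in> L" using T \<open>F \<subseteq> L\<close> by auto
  show ?thesis unfolding j0_def s0_def
    by (auto intro!: L.mem_intros \<open>T \<in> L\<close> \<open>w 0 \<in> L\<close>)
qed

lemma j_mem: "subfield_set L \<Longrightarrow> F \<subseteq> L \<Longrightarrow> w n \<in> L \<Longrightarrow> j n \<in> L"
proof -
  assume "subfield_set L" "F \<subseteq> L" "w n \<in> L"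
  then interpret L: subfield_set L by simp
  have "T \<in> L" using T \<open>F \<subseteq> L\<close> by auto
  show ?thesis unfolding j_def s_def
    by (auto intro!: L.mem_intros \<open>T \<in> L\<close> \<open>w n \<in> L\<close>)
qed

lemma K_0: "K 0 = adjoin F {w 0}"
proof
  have 1: "F \<union> {w 0} \<subseteq> adjoin F {w 0}" "subfield_set (adjoin F {w 0})"
    by (simp_all only: adjoin_incl subfield_set_adjoin)
  hence 2: "F \<subseteq> adjoin F {w 0}" "w 0 \<in> adjoin F {w 0}" "s0 \<in> adjoin F {w 0}" "j0 \<in> adjoin F {w 0}"
    using s0_j0_mem by blast+
  have "adjoin F {j0} \<subseteq> adjoin F {w 0}"
    by (rule adjoin_least[OF 1(2)]) (use 2 in blast)
  hence "adjoin (adjoin F {j0}) {s0} \<subseteq> adjoin F {w 0}"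
    by (intro adjoin_least[OF 1(2)]) (use 2 in blast)
  thus "K 0 \<subseteq> adjoin F {w 0}"
    unfolding K.simps by (intro adjoin_least[OF 1(2)]) (use 2 in blast)
  show "adjoin F {w 0} \<subseteq> K 0"
    using F_subset(1) F_subset(2)[of 0] w_mem[of 0] by (intro adjoin_least subfield_set_K) blast
qed

end

section \<open>Total ramification and generation by two \<open>j\<close>-invariants\<close>

locale generic_drinfeld_tower = drinfeld_tower +
  assumes j0_transcendental: "p \<in> poly_over F \<Longrightarrow> poly p j0 = 0 \<Longrightarrow> p = 0"
begin

lemma w0_transcendental:
  "p \<in> poly_over F \<Longrightarrow> poly p (w 0) = 0 \<Longrightarrow> p = 0"
proof (rule transcendental_of_mem_adjoin[OF F j0_transcendental])
  show "j0 \<in> adjoin F {w 0}"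
    using s0_j0_mem[OF subfield_set_adjoin[of F "{w 0}"]] adjoin_incl[of F "{w 0}"] by auto
qed auto

text \<open>At a place where \<open>w 0\<close> vanishes, \<open>w n\<close> plays the part of a
  uniformizer: \<open>inverse (j n)\<close> has its valuation and \<open>inverse j0\<close> has
  \<open>q ^ (n + 2)\<close> times its valuation.\<close>

lemma no_relation:
  assumes p: "p \<in> poly_over (adjoin F {j0})" "Polynomial.degree p < q ^ (n + 2)" "poly p (j n) = 0"
  shows "p = 0"
proof -
  obtain V where V: "valuation_ring V" "F \<subseteq> V" "inverse (w 0) \<notin> V" "w 0 \<noteq> 0"
    using exists_valuation_ring[OF F w0_transcendental] by blast
  interpret V: valuation_ring V by fact
  have uT: "V.unit T" using T V(2) F.inverse_mem[OF T(1)] by (auto simp: V.unit_def)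
  have u1: "V.unit (1 + x)" if "V.nonunit x" for x
    using V.unit_add_nonunit[OF V.unit_1 that] .
  have nw: "V.nonunit (w i)" for i
  proof (induction i)
    case 0
    show ?case using V by (simp add: V.nonunit_def)
  next
    case (Suc i)
    define a where "a = w i * (T ^ (q - 1) / (1 + w i) ^ q)"
    have "V.unit (T ^ (q - 1) / (1 + w i) ^ q)"
      by (intro V.unit_divide V.unit_power uT u1 Suc)
    hence a: "V.nonunit a" unfolding a_def by (intro V.nonunit_mult Suc) (simp add: V.unit_def)
    have eq: "w (Suc i) ^ q = a * (1 + w (Suc i))"
      using rel[of i] w[of i] by (simp add: a_def field_simps)
    \<comment> \<open>\<open>w (Suc i)\<close> satisfies a monic equation over \<open>V\<close>. If
      it were outside, dividing by its \<open>q\<close>-th power would write 1 as a multiple of the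
      nonunit \<open>a\<close>.\<close>
    have "w (Suc i) \<in> V"
    proof (rule ccontr)
      assume *: "w (Suc i) \<notin> V"
      define v where "v = inverse (w (Suc i))"
      have v: "v \<in> V" "v \<noteq> 0" "w (Suc i) = inverse v"
        using V.mem_or_inverse_mem[of "w (Suc i)"] * w by (auto simp: v_def)
      have "v ^ q * w (Suc i) ^ q = a * (v ^ q + v ^ (q - 1) * (v * w (Suc i)))"
        unfolding eq using q by (simp add: algebra_simps power_eq_if)
      hence "1 = a * (v ^ q + v ^ (q - 1))"
        using v by (simp add: power_mult_distrib[symmetric])
      moreover have "V.nonunit (a * (v ^ q + v ^ (q - 1)))"
        by (intro V.nonunit_mult a V.add_mem V.power_mem v)
      ultimately show False using V.unit_1 by (simp add: V.unit_iff)
    qed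
    hence "V.nonunit (w (Suc i) ^ q)"
      unfolding eq by (intro V.nonunit_mult a V.add_mem V.one_mem)
    thus ?case using V.nonunit_of_power q by auto
  qed
  have ww: "\<exists>u. V.unit u \<and> w 0 = w i ^ (q ^ i) * u" for i
  proof (induction i)
    case 0
    show ?case by (intro exI[of _ 1]) (simp add: V.unit_1)
  next
    case (Suc i)
    then obtain u where u: "V.unit u" "w 0 = w i ^ (q ^ i) * u" by blast
    \<comment> \<open>This unit turns \<open>rel\<close> into
      \<open>w i = w (Suc i) ^ q * b\<close>.\<close>
    define b where "b = (1 + w i) ^ q / (T ^ (q - 1) * (1 + w (Suc i)))"
    have b: "V.unit b" unfolding b_def
      by (intro V.unit_divide V.unit_mult V.unit_power uT u1 nw)
    have "w i = w (Suc i) ^ q * b"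
      using rel[of i] w(2)[of "Suc i"] T(2) by (simp add: b_def eq_divide_eq mult_ac)
    hence "w 0 = w (Suc i) ^ (q ^ Suc i) * (b ^ (q ^ i) * u)"
      using u by (simp add: power_mult_distrib power_mult[symmetric] mult_ac)
    thus ?case using u b by (intro exI[of _ "b ^ (q ^ i) * u"]) (auto intro: V.unit_mult V.unit_power)
  qed
  obtain u where u: "V.unit u" "w 0 = w n ^ (q ^ n) * u" using ww by blast
  have q2: "q > 0" using q by simp
  \<comment> \<open>\<open>c\<close> and \<open>d\<close> are the unit parts of \<open>s0\<close>
    and \<open>s0 + T\<close>, which both have denominator \<open>w 0 ^ q\<close>. So
    \<open>inverse j0 = s0 / (s0 + T) ^ (q + 1)\<close> has exponent
    \<open>q * (q + 1) - q = q * q\<close> in \<open>w 0\<close>.\<close>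
  define c where "c = T ^ q * (1 + w 0)"
  have c: "V.unit c" unfolding c_def by (intro V.unit_mult V.unit_power uT u1 nw)
  define d where "d = c + w 0 ^ q * T"
  have d: "V.unit d" unfolding d_def
    by (intro V.unit_add_nonunit c V.nonunit_mult V.nonunit_power nw q2) (use uT in \<open>simp add: V.unit_def\<close>)
  have s0: "s0 = c / w 0 ^ q" by (simp add: s0_def c_def)
  have "s0 + T = d / w 0 ^ q" using w by (simp add: s0 d_def field_simps)
  hence "inverse j0 = (c / w 0 ^ q) * (w 0 ^ q) ^ (q + 1) / d ^ (q + 1)"
    by (simp add: j0_def s0 power_divide)
  also have "\<dots> = w 0 ^ (q * q) * (c / d ^ (q + 1))"
    using w by (simp add: power_mult field_simps)
  also have "\<dots> = w n ^ (q ^ (n + 2)) * (u ^ (q * q) * (c / d ^ (q + 1)))"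
    by (subst u(2)) (simp add: power_mult_distrib power_mult[symmetric] power_add mult_ac power2_eq_square)
  finally have 1: "inverse j0 = w n ^ (q ^ (n + 2)) * (u ^ (q * q) * (c / d ^ (q + 1)))" .
  \<comment> \<open>Likewise \<open>s n\<close> and \<open>T ^ q + s n\<close> have denominator
    \<open>w n\<close>, which leaves the exponent \<open>(q + 1) - q = 1\<close> for
    \<open>inverse (j n)\<close>.\<close>
  define e where "e = T * (1 + w n) ^ q"
  have e: "V.unit e" unfolding e_def by (intro V.unit_mult V.unit_power uT u1 nw)
  define f where "f = e + w n * T ^ q"
  have f: "V.unit f" unfolding f_def
    by (intro V.unit_add_nonunit e V.nonunit_mult nw) (use V.unit_power[OF uT] in \<open>simp add: V.unit_def\<close>)
  have s: "s n = e / w n" by (simp add: s_def e_def)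
  have "T ^ q + s n = f / w n" using w by (simp add: s f_def field_simps)
  hence "inverse (j n) = (e / w n) ^ q * w n ^ (q + 1) / f ^ (q + 1)"
    by (simp add: j_def s power_divide)
  also have "\<dots> = w n * (e ^ q / f ^ (q + 1))"
    using w by (simp add: power_divide field_simps)
  finally have 2: "inverse (j n) = w n * (e ^ q / f ^ (q + 1))" .
  show ?thesis
  proof (rule V.totally_ramified_no_relation[OF F V(2) nw w(1) _ 1 _ 2 _ p])
    show "V.unit (u ^ (q * q) * (c / d ^ (q + 1)))" "V.unit (e ^ q / f ^ (q + 1))"
      by (intro V.unit_divide V.unit_mult V.unit_power u c d e f)+
    show "0 < q ^ (n + 2)" using q2 by simp
  qed
qed

lemma adjoin_j: "adjoin F {j0, j n} = K n"
proof -
  interpret R: field "type_ring :: 'a ring" by (rule field_from_type_algebra)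
  define K0 where "K0 = adjoin F {j0}"
  define L where "L = adjoin K0 {j n}"
  have sK0: "subfield_set K0" and sL: "subfield_set L"
    by (simp_all add: K0_def L_def subfield_set_adjoin)
  have L: "L = adjoin F {j0, j n}"
  proof
    show "L \<subseteq> adjoin F {j0, j n}" unfolding L_def K0_def
      using adjoin_incl[of F "{j0, j n}"]
        adjoin_least[OF subfield_set_adjoin[of F "{j0, j n}"], of F "{j0}"]
      by (intro adjoin_least subfield_set_adjoin) auto
    show "adjoin F {j0, j n} \<subseteq> L"
      using adjoin_incl[of K0 "{j n}"] adjoin_incl[of F "{j0}"]
      by (intro adjoin_least[OF sL]) (auto simp: L_def K0_def)
  qed
  have jK: "j n \<in> K n"
    using j_mem[OF subfield_set_K _ w_mem] F_subset by blast
  have LK: "L \<subseteq> K n"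
    unfolding L_def K0_def using F_subset jK by (intro adjoin_least subfield_set_K) auto
  obtain d where d: "d \<le> (q + 1) * q ^ (n + 1)" "R.dimension d K0 (K n)"
    using dimension_K[of n] by (auto simp: K0_def)
  have "(R.algebraic over K0) (j n)"
    by (rule R.finite_dimension_imp_algebraic[OF _ _ R.finite_dimensionI[OF d(2)] jK])
      (use sK0 subfield_set_K[of n] in \<open>auto simp: subfield_type_ring_iff[symmetric] dest: subfieldE(1)\<close>)
  hence ex: "\<exists>p\<in>poly_over K0. p \<noteq> 0 \<and> poly p (j n) = 0"
    using transcendental_type_ring_iff[OF sK0] by (auto simp: over_def)
  then obtain p where p: "p \<in> poly_over K0" "p \<noteq> 0" "poly p (j n) = 0" by blast
  have "R.simple_extension K0 (j n) = L"
    unfolding L_def by (rule simple_extension_eq_adjoin[OF sK0 simple_extension_root(1)[OF sK0 p]])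
  moreover have "\<exists>m \<ge> q ^ (n + 2). R.dimension m K0 (R.simple_extension K0 (j n))"
    by (rule dimension_simple_extension_ge[OF sK0 ex]) (use no_relation[of _ n] in \<open>auto simp: K0_def\<close>)
  ultimately obtain m where m: "m \<ge> q ^ (n + 2)" "R.dimension m K0 L" by auto
  \<comment> \<open>This makes the upper bound \<open>(q + 1) * q ^ (n + 1)\<close> smaller than
    twice the lower bound \<open>q ^ (n + 2)\<close>.\<close>
  have "q + 1 < 2 * q" using q by simp
  hence "(q + 1) * q ^ (n + 1) < (2 * q) * q ^ (n + 1)"
    using q by (intro mult_strict_right_mono) auto
  hence "(q + 1) * q ^ (n + 1) < 2 * q ^ (n + 2)" by simp
  hence "d < 2 * m" using d(1) m(1) by linarith
  moreover have "K0 \<subseteq> L" using adjoin_incl by (auto simp: L_def)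
  ultimately have "L = K n"
    using dimension_lower_bound_imp_eq[OF sK0 sL subfield_set_K _ LK m(2) d(2)] by simp
  thus ?thesis using L by simp
qed

end

section \<open>Linearized polynomials\<close>

text \<open>Multiplication by a nonzero \<open>x\<close> permutes the nonzero elements; compare
  their products.\<close>

lemma finite_field_power_card:
  fixes x :: "'q::{field,finite}"
  shows "x ^ CARD('q) = x"
proof (cases "x = 0")
  case False
  have "(\<Prod>y\<in>UNIV - {0}. x * y) = (\<Prod>y\<in>UNIV - {0}. y)"
    by (rule prod.reindex_bij_witness[of _ "\<lambda>y. y / x" "\<lambda>y. x * y"]) (use False in auto)
  hence "x ^ card (UNIV - {0 :: 'q}) * (\<Prod>y\<in>UNIV - {0}. y) = (\<Prod>y\<in>UNIV - {0}. y)"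
    by (simp add: prod.distrib)
  hence "x ^ (CARD('q) - 1) = 1" by simp
  thus ?thesis by (simp add: power_eq_if)
qed simp

lemma card_field_ge_2: "CARD('q::{field,finite}) \<ge> 2"
  using card_mono[of "UNIV :: 'q set" "{0, 1}"] by simp

text \<open>The codomain is only an integral domain, so that the results hold both for the big field
  and for its polynomial ring (\<open>Fq_algebra_poly\<close>).\<close>

locale Fq_algebra =
  fixes h :: "'q::{field,finite} \<Rightarrow> 'a::idom" and q :: nat
  assumes h_add: "h (x + y) = h x + h y" and h_mult: "h (x * y) = h x * h y" and h_1: "h 1 = 1"
    and q_eq: "q = CARD('q)"
begin

lemma q_ge_2: "q \<ge> 2"
  using card_field_ge_2 q_eq by metis

lemma h_0: "h 0 = 0"
  using h_add[of 0 0] by (metis add_cancel_right_right)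

lemma h_eq_0_iff: "h x = 0 \<longleftrightarrow> x = 0"
  using h_mult[of x "inverse x"] h_1 h_0 by (cases "x = 0") auto

lemma h_diff: "h (x - y) = h x - h y"
  using h_add[of "x - y" y] by simp

lemma h_eq_iff: "h x = h y \<longleftrightarrow> x = y"
  using h_eq_0_iff[of "x - y"] by (simp add: h_diff)

lemma card_range_h: "card (range h) = q"
  unfolding q_eq by (rule card_image) (simp add: inj_on_def h_eq_iff)

lemma h_power: "h (x ^ n) = h x ^ n"
  by (induction n) (simp_all add: h_1 h_mult)

lemma h_power_card: "h c ^ q = h c"
  by (simp add: q_eq h_power[symmetric] finite_field_power_card)

text \<open>As polynomials in \<open>y\<close>, both sides are monic of degree \<open>q\<close> and
  vanish at the \<open>q\<close> elements of \<open>range h\<close>.\<close>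

lemma power_card_minus_self: "(y :: 'a) ^ q - y = (\<Prod>c\<in>UNIV. y - h c)"
proof -
  define P where "P = (\<Prod>c\<in>UNIV. [:- h c, 1:])"
  have deg: "Polynomial.degree P = q"
    unfolding P_def by (subst degree_prod_eq_sum_degree) (auto simp: q_eq)
  have "Polynomial.monom 1 q - Polynomial.monom 1 1 = P"
  proof (rule poly_eqI_degree_lead_coeff[where A = "range h" and n = q])
    have "poly.coeff P q = 1"
      using lead_coeff_prod[of "\<lambda>c. [:- h c, 1:]" UNIV] deg by (simp add: P_def)
    thus "poly.coeff (Polynomial.monom 1 q - Polynomial.monom 1 1) q = poly.coeff P q"
      using q_ge_2 by simp
    show "Polynomial.degree (Polynomial.monom 1 q - Polynomial.monom (1::'a) 1) \<le> q"
      using q_ge_2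
      by (intro degree_diff_le order.trans[OF degree_monom_le]) auto
    show "poly (Polynomial.monom 1 q - Polynomial.monom 1 1) z = poly P z" if "z \<in> range h" for z
      using that by (auto simp: P_def poly_prod poly_monom h_power_card prod_zero_iff)
  qed (auto simp: deg card_range_h)
  hence "poly (Polynomial.monom 1 q - Polynomial.monom 1 1) y = poly P y" by simp
  thus ?thesis by (simp add: P_def poly_prod poly_monom)
qed

text \<open>Translating \<open>y\<close> by an element of \<open>\<bbbF>\<^sub>q\<close> permutes the factors of \<open>y\<^sup>q - y\<close>, so
  \<open>(X + y)\<^sup>q\<close> and \<open>X\<^sup>q + y\<^sup>q\<close> agree on \<open>\<bbbF>\<^sub>q\<close>.\<close>

lemma add_power_card: "(x + y :: 'a) ^ q = x ^ q + y ^ q"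
proof -
  have q: "q \<ge> 2" by (rule q_ge_2)
  have *: "(h c + y) ^ q = h c + y ^ q" for c
  proof -
    have "(\<Prod>c'\<in>UNIV. (h c + y) - h c') = (\<Prod>c'\<in>UNIV. y - h c')"
      by (rule prod.reindex_bij_witness[of _ "\<lambda>d. d + c" "\<lambda>d. d - c"]) (auto simp: h_diff h_add)
    hence "(h c + y) ^ q - (h c + y) = y ^ q - y"
      by (simp add: power_card_minus_self)
    thus ?thesis by (simp add: algebra_simps)
  qed
  have deg: "Polynomial.degree ([:y, 1:] ^ q) = q" by (subst degree_power_eq) auto
  have "[:y, 1:] ^ q = Polynomial.monom 1 q + [:y ^ q:]"
  proof (rule poly_eqI_degree_lead_coeff[where A = "range h" and n = q])
    show "poly.coeff ([:y, 1:] ^ q) q = poly.coeff (Polynomial.monom 1 q + [:y ^ q:]) q"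
      using lead_coeff_power[of "[:y, 1:]" q] deg q by (simp add: coeff_pCons split: nat.splits)
    show "Polynomial.degree (Polynomial.monom 1 q + [:y ^ q:]) \<le> q"
      by (intro degree_add_le order.trans[OF degree_monom_le]) auto
    show "poly ([:y, 1:] ^ q) z = poly (Polynomial.monom 1 q + [:y ^ q:]) z" if "z \<in> range h" for z
      using that * by (auto simp: poly_monom h_power_card add.commute)
  qed (auto simp: deg card_range_h)
  hence "poly ([:y, 1:] ^ q) x = poly (Polynomial.monom 1 q + [:y ^ q:]) x" by simp
  thus ?thesis by (simp add: poly_monom add.commute)
qed

lemma minus_power_card: "(- x :: 'a) ^ q = - (x ^ q)"
  using add_power_card[of x "- x"] q_ge_2 by (simp add: eq_neg_iff_add_eq_0 add.commute power_0_left)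

lemma minus_power_Suc_card: "(- x :: 'a) ^ (q + 1) = x ^ (q + 1)"
  by (simp add: minus_power_card)

lemma diff_power_card: "(x - y :: 'a) ^ q = x ^ q - y ^ q"
  using add_power_card[of x "- y"] by (simp add: minus_power_card)

text \<open>Replacing \<open>c\<close> by \<open>c + 1\<close> permutes the summands of the sum over
  the finite field but adds \<open>q\<close> to the total.\<close>

lemma of_nat_card: "of_nat q = (0 :: 'a)"
proof -
  have "(\<Sum>c\<in>UNIV. h c) = (\<Sum>c\<in>UNIV. h (c + 1))"
    by (rule sum.reindex_bij_witness[of _ "\<lambda>d. d + 1" "\<lambda>d. d - 1"]) auto
  thus ?thesis by (simp add: h_add h_1 sum.distrib q_eq)
qed

lemma Fq_algebra_poly: "Fq_algebra (\<lambda>c. [:h c:]) q"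
  by standard (simp_all add: h_add h_mult h_1 one_pCons q_eq)

lemma pderiv_linearized:
  fixes u :: "'a poly"
  assumes "\<And>i. poly.coeff u i \<noteq> 0 \<Longrightarrow> \<exists>k. i = q ^ k"
  shows "pderiv u = [:poly.coeff u 1:]"
proof (rule poly_eqI)
  fix n
  show "poly.coeff (pderiv u) n = poly.coeff [:poly.coeff u 1:] n"
  proof (cases "poly.coeff u (Suc n) = 0 \<or> n = 0")
    case True
    thus ?thesis by (auto simp: coeff_pderiv coeff_pCons split: nat.splits)
  next
    case False
    then obtain k where k: "Suc n = q ^ k" using assms by blast
    hence "k > 0" using False by (cases k) auto
    hence "of_nat (Suc n) = (0 :: 'a)"
      unfolding k of_nat_power of_nat_card by simp
    thus ?thesis using False by (simp add: coeff_pderiv coeff_pCons del: of_nat_Suc split: nat.splits)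
  qed
qed

end

text \<open>A double root would be a root of the constant derivative, so \<open>u\<close> has as
  many roots as its degree. Then \<open>u\<close> and the multiple of \<open>m\<close> agree at all
  of them and in the leading coefficient.\<close>

lemma eq_smult_of_simple_roots:
  fixes u m :: "'a::alg_closed_field poly"
  assumes pd: "pderiv u = [:c:]" "c \<noteq> 0"
    and m: "poly.coeff m (card {x. poly u x = 0}) = 1" "Polynomial.degree m \<le> card {x. poly u x = 0}"
    and roots: "\<And>x. poly u x = 0 \<Longrightarrow> poly m x = 0"
  shows "u = Polynomial.smult (poly.coeff u (Polynomial.degree u)) m"
proof -
  define l where "l = poly.coeff u (Polynomial.degree u)"
  have u0: "u \<noteq> 0" using pd by auto
  hence l: "l \<noteq> 0" by (simp add: l_def)
  obtain A where A: "size A = Polynomial.degree u" "u = Polynomial.smult l (\<Prod>x\<in>#A. [:-x, 1:])"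
    using alg_closed_imp_factorization[OF u0] unfolding l_def by blast
  have roots_A: "{x. poly u x = 0} = set_mset A"
    using l by (subst A(2)) (auto simp: poly_prod_mset prod_mset_zero_iff)
  have "count A x \<le> 1" for x
  proof (rule ccontr)
    assume "\<not> ?thesis"
    then obtain B where B: "A = add_mset x (add_mset x B)"
      by (metis One_nat_def count_add_mset count_eq_zero_iff diff_Suc_1 insert_DiffM mset_add not_less_eq_eq le0)
    define r where "r = Polynomial.smult l (\<Prod>x\<in>#B. [:-x, 1:])"
    have "u = [:-x, 1:] * ([:-x, 1:] * r)"
      by (subst A(2)) (simp add: B r_def mult_ac)
    hence "pderiv u = pderiv ([:-x, 1:] * ([:-x, 1:] * r))" by (rule arg_cong)
    hence "poly (pderiv u) x = 0" by (simp only: pderiv_mult poly_add poly_mult) simp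
    thus False using pd by simp
  qed
  hence "A = mset_set (set_mset A)"
    by (intro multiset_eqI) (metis count_mset_set(1,3) finite_set_mset le_neq_implies_less less_one
        count_greater_eq_one_iff count_eq_zero_iff)
  hence card: "card {x. poly u x = 0} = Polynomial.degree u"
    using A(1) by (metis roots_A size_mset_set)
  have "u = Polynomial.smult l m"
  proof (rule poly_eqI_degree_lead_coeff[where A = "{x. poly u x = 0}" and n = "Polynomial.degree u"])
    show "Polynomial.degree (Polynomial.smult l m) \<le> Polynomial.degree u"
      using m card by (intro order.trans[OF degree_smult_le]) simp
  qed (use m card roots in \<open>auto simp: l_def\<close>)
  thus ?thesis by (simp add: l_def)
qed

section \<open>Quotients of rank two Drinfeld modules by a line\<close>

lemma pcompose_monom: "pcompose (Polynomial.monom c n) p = Polynomial.smult c (p ^ n)"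
  for p :: "'a::comm_semiring_1 poly"
  by (induction n) (simp_all add: monom_0 monom_Suc pcompose_pCons)

lemma to_fract_power: "to_fract (x ^ n) = to_fract x ^ n"
  by (induction n) simp_all

locale constant_field_embedding =
  fixes \<iota> :: "'q::{field,finite} poly fract \<Rightarrow> 'k::alg_closed_field" and q :: nat
  assumes embedding: "base_embedding \<iota>" and q_card: "q = CARD('q)"
begin

lemma \<iota>_hom: "\<iota> (x + y) = \<iota> x + \<iota> y" "\<iota> (x * y) = \<iota> x * \<iota> y" "\<iota> 1 = 1"
  using embedding ring_hom_add[of \<iota> type_ring type_ring] ring_hom_mult[of \<iota> type_ring type_ring]
    ring_hom_one[of \<iota> type_ring type_ring]
  unfolding base_embedding_def by simp_all

lemma \<iota>_0: "\<iota> 0 = 0"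
  using \<iota>_hom(1)[of 0 0] by (metis add_cancel_right_right)

lemma \<iota>_uminus: "\<iota> (- x) = - \<iota> x"
  using \<iota>_hom(1)[of x "- x"] \<iota>_0 by (simp add: eq_neg_iff_add_eq_0 add.commute)

lemma \<iota>_eq_0_iff: "\<iota> x = 0 \<longleftrightarrow> x = 0"
  using \<iota>_hom(2)[of x "inverse x"] \<iota>_hom(3) \<iota>_0 by (cases "x = 0") auto

lemma \<iota>_inverse: "\<iota> (inverse x) = inverse (\<iota> x)"
  using \<iota>_hom(2)[of x "inverse x"] \<iota>_hom(3) \<iota>_0 by (cases "x = 0") (auto intro: inverse_unique[symmetric])

lemma \<iota>_eq_iff: "\<iota> x = \<iota> y \<longleftrightarrow> x = y"
  using \<iota>_eq_0_iff[of "x - y"] \<iota>_hom(1)[of "x - y" y] by auto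

lemma \<iota>_power: "\<iota> (x ^ n) = \<iota> x ^ n"
  by (induction n) (simp_all add: \<iota>_hom)

lemma subfield_set_range: "subfield_set (range \<iota>)"
proof
  show "1 \<in> range \<iota>" using \<iota>_hom(3) by (metis rangeI)
  fix x y assume "x \<in> range \<iota>" "y \<in> range \<iota>"
  then obtain a b where "x = \<iota> a" "y = \<iota> b" by auto
  thus "x + y \<in> range \<iota>" "x * y \<in> range \<iota>" "- x \<in> range \<iota>" "inverse x \<in> range \<iota>"
    by (auto simp: \<iota>_hom[symmetric] \<iota>_uminus[symmetric] \<iota>_inverse[symmetric])
qed

definition h :: "'q \<Rightarrow> 'k" where "h c = \<iota> (to_fract [:c:])"

definition \<Theta> :: 'k where "\<Theta> = \<iota> (to_fract T_elem)"

sublocale Fq_algebra h q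
proof
  show "h (x * y) = h x * h y" for x y
    by (simp add: h_def \<iota>_hom[symmetric] to_fract_mult[symmetric] mult.commute del: to_fract_mult)
  show "h (x + y) = h x + h y" for x y
    by (simp add: h_def \<iota>_hom[symmetric] to_fract_add[symmetric] del: to_fract_add)
  show "h 1 = 1" by (simp add: h_def one_pCons[symmetric] \<iota>_hom)
qed (fact q_card)

lemma \<Theta>_nonzero: "\<Theta> \<noteq> 0"
  by (simp add: \<Theta>_def \<iota>_eq_0_iff)

text \<open>Generic characteristic, in the form in which it makes isogenies separable.\<close>

lemma \<Theta>_power_eq_imp: "\<Theta> ^ n = \<Theta> \<Longrightarrow> n = 1"
proof -
  assume "\<Theta> ^ n = \<Theta>"
  hence "\<iota> (to_fract (T_elem ^ n)) = \<iota> (to_fract (T_elem :: 'q poly))"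
    by (simp add: \<Theta>_def \<iota>_power[symmetric] to_fract_power)
  hence "(T_elem :: 'q poly) ^ n = T_elem" by (simp add: \<iota>_eq_iff)
  hence "Polynomial.degree ((T_elem :: 'q poly) ^ n) = Polynomial.degree (T_elem :: 'q poly)" by simp
  thus ?thesis by (simp add: degree_power_eq)
qed

lemma q_exponents: "q \<noteq> 1" "q ^ 2 \<noteq> 1" "q ^ 3 \<noteq> 1" "q ^ 2 \<noteq> q" "q ^ 3 \<noteq> q" "q ^ 3 \<noteq> q ^ 2" "q > 0"
  using q_ge_2 power_inject_exp[of q 2 0] power_inject_exp[of q 3 0] power_inject_exp[of q 2 1]
    power_inject_exp[of q 3 1] power_inject_exp[of q 3 2] by simp_all

text \<open>The polynomials \<open>\<phi>\<^sub>T = \<Delta>\<tau>\<^sup>2 + g\<tau> + T\<close> and \<open>\<tau> - x^(q - 1)\<close>, the latter with kernel \<open>\<bbbF>\<^sub>q x\<close>.\<close>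

definition rank2_poly :: "'k \<Rightarrow> 'k \<Rightarrow> 'k poly" where
  "rank2_poly g d = Polynomial.monom \<Theta> 1 + Polynomial.monom g q + Polynomial.monom d (q ^ 2)"

definition line_poly :: "'k \<Rightarrow> 'k poly" where
  "line_poly x = Polynomial.monom 1 q - Polynomial.monom (x ^ (q - 1)) 1"

lemma poly_rank2: "poly (rank2_poly g d) t = \<Theta> * t + g * t ^ q + d * t ^ (q ^ 2)"
  by (simp add: rank2_poly_def poly_monom)

lemma poly_line: "poly (line_poly x) t = t ^ q - x ^ (q - 1) * t"
  by (simp add: line_poly_def poly_monom)

lemma power_q_pred: "x ^ (q - 1) * x = (x :: 'k) ^ q"
  using q_exponents(7) by (rule power_minus_mult)

lemma poly_line_self: "poly (line_poly x) x = 0"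
  by (simp only: poly_line power_q_pred diff_self)

lemma poly_line_add: "poly (line_poly x) (s + t) = poly (line_poly x) s + poly (line_poly x) t"
  by (simp add: poly_line add_power_card algebra_simps)

lemma poly_line_h: "poly (line_poly x) (h c * t) = h c * poly (line_poly x) t"
  by (simp add: poly_line power_mult_distrib h_power_card algebra_simps)

lemma degree_line: "Polynomial.degree (line_poly x) = q"
proof (rule antisym)
  show "Polynomial.degree (line_poly x) \<le> q"
    unfolding line_poly_def using q_ge_2 by (intro degree_diff_le order.trans[OF degree_monom_le]) auto
  show "q \<le> Polynomial.degree (line_poly x)"
    by (rule le_degree) (use q_exponents(1) in \<open>auto simp: line_poly_def\<close>)
qed

lemma lead_coeff_line: "poly.coeff (line_poly x) q = 1"
  using q_exponents(1) by (simp add: line_poly_def)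

lemma pcompose_line_rank2:
  "pcompose (Polynomial.smult a (line_poly x)) (rank2_poly g d) =
     Polynomial.monom (a * d ^ q) (q ^ 3) + Polynomial.monom (a * (g ^ q - x ^ (q - 1) * d)) (q ^ 2)
     + Polynomial.monom (a * (\<Theta> ^ q - x ^ (q - 1) * g)) q - Polynomial.monom (a * x ^ (q - 1) * \<Theta>) 1"
proof -
  interpret P: Fq_algebra "\<lambda>c. [:h c:]" q by (rule Fq_algebra_poly)
  have "rank2_poly g d ^ q = Polynomial.monom (\<Theta> ^ q) q + Polynomial.monom (g ^ q) (q ^ 2)
      + Polynomial.monom (d ^ q) (q ^ 3)"
    by (simp add: rank2_poly_def P.add_power_card monom_power power2_eq_square power3_eq_cube)
  thus ?thesis
    by (intro poly_eqI)
      (simp add: line_poly_def pcompose_smult pcompose_diff pcompose_monom rank2_poly_def algebra_simps)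
qed

lemma pcompose_rank2_line:
  "pcompose (rank2_poly g d) (Polynomial.smult a (line_poly x)) =
     Polynomial.monom (d * a ^ (q ^ 2)) (q ^ 3)
     + Polynomial.monom (g * a ^ q - d * (a * x ^ (q - 1)) ^ (q ^ 2)) (q ^ 2)
     + Polynomial.monom (\<Theta> * a - g * (a * x ^ (q - 1)) ^ q) q - Polynomial.monom (a * x ^ (q - 1) * \<Theta>) 1"
proof -
  interpret P: Fq_algebra "\<lambda>c. [:h c:]" q by (rule Fq_algebra_poly)
  define r where "r = x ^ (q - 1)"
  have 0: "Polynomial.smult a (line_poly x) = Polynomial.monom a q - Polynomial.monom (a * r) 1"
    by (simp add: line_poly_def r_def smult_diff_right smult_monom)
  have 1: "Polynomial.smult a (line_poly x) ^ q = Polynomial.monom (a ^ q) (q ^ 2) - Polynomial.monom ((a * r) ^ q) q"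
    unfolding 0 by (simp add: P.diff_power_card monom_power power2_eq_square)
  have 2: "Polynomial.smult a (line_poly x) ^ (q ^ 2) =
      Polynomial.monom (a ^ (q ^ 2)) (q ^ 3) - Polynomial.monom ((a * r) ^ (q ^ 2)) (q ^ 2)"
    unfolding power2_eq_square[of q] power_mult 1
    by (simp add: P.diff_power_card monom_power power2_eq_square power3_eq_cube)
  show ?thesis
    unfolding rank2_poly_def pcompose_add pcompose_monom 1 2 power_one_right r_def[symmetric]
    by (intro poly_eqI) (simp add: 0 algebra_simps)
qed

text \<open>These are the coefficients of \<open>\<tau>^3\<close>, \<open>\<tau>^2\<close> and
  \<open>\<tau>\<close>; the constant terms on the two sides always agree.\<close>

lemma commute_iff:
  "pcompose (Polynomial.smult a (line_poly x)) (rank2_poly g d) =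
     pcompose (rank2_poly g' d') (Polynomial.smult a (line_poly x)) \<longleftrightarrow>
   a * d ^ q = d' * a ^ (q ^ 2) \<and>
   a * (g ^ q - x ^ (q - 1) * d) = g' * a ^ q - d' * (a * x ^ (q - 1)) ^ (q ^ 2) \<and>
   a * (\<Theta> ^ q - x ^ (q - 1) * g) = \<Theta> * a - g' * (a * x ^ (q - 1)) ^ q" (is "?l = ?r \<longleftrightarrow> ?rhs")
proof
  assume *: "?l = ?r"
  have "poly.coeff ?l (q ^ 3) = poly.coeff ?r (q ^ 3)" "poly.coeff ?l (q ^ 2) = poly.coeff ?r (q ^ 2)"
    "poly.coeff ?l q = poly.coeff ?r q"
    unfolding * by (rule refl)+
  thus ?rhs
    unfolding pcompose_line_rank2 pcompose_rank2_line
    using q_exponents q_exponents(1-6)[symmetric] by simp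
next
  assume ?rhs
  thus "?l = ?r" unfolding pcompose_line_rank2 pcompose_rank2_line by simp
qed

text \<open>Writing the exponent \<open>q ^ 2 - 1\<close> as \<open>(q - 1) * (q + 1)\<close> lets
  everything be expressed through \<open>x ^ (q - 1)\<close>, the constant of
  \<open>line_poly x\<close>.\<close>

lemma power_q2: "x ^ (q ^ 2) = (x ^ (q - 1)) ^ (q + 1) * (x :: 'k)"
proof -
  have "x ^ (q ^ 2) = (x ^ (q - 1) * x) ^ q"
    by (simp only: power_q_pred) (simp add: power2_eq_square power_mult)
  also have "\<dots> = (x ^ (q - 1)) ^ q * (x ^ (q - 1) * x)"
    by (subst power_mult_distrib) (simp only: power_q_pred)
  finally show ?thesis by simp
qed

text \<open>A single step of the chain: the isogeny with kernel spanned by \<open>x\<close> goes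
  from the module \<open>(g, d)\<close> to \<open>(g', d')\<close>, and \<open>s\<close> is
  \<open>d * x ^ (q ^ 2 - 1)\<close>.\<close>

context
  fixes a x g d g' d' s :: 'k
  assumes nz: "a \<noteq> 0" "x \<noteq> 0" "d \<noteq> 0"
    and comm: "pcompose (Polynomial.smult a (line_poly x)) (rank2_poly g d) =
                 pcompose (rank2_poly g' d') (Polynomial.smult a (line_poly x))"
    and root: "poly (rank2_poly g d) x = 0"
    and s: "s = d * (x ^ (q - 1)) ^ (q + 1)"
begin

lemma s_nonzero: "s \<noteq> 0" using nz s by simp

lemma g_eq: "x ^ (q - 1) * g = - (s + \<Theta>)"
proof -
  have "(\<Theta> + x ^ (q - 1) * g + s) * x = poly (rank2_poly g d) x"
    unfolding poly_rank2 power_q2 s power_q_pred[symmetric, of x] by (simp add: algebra_simps)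
  hence "\<Theta> + x ^ (q - 1) * g + s = 0" using root nz by simp
  thus ?thesis by (subst eq_neg_iff_add_eq_0) (simp only: add_ac)
qed

lemma j_source: "g ^ (q + 1) / d = (s + \<Theta>) ^ (q + 1) / s"
proof -
  have "(x ^ (q - 1) * g) ^ (q + 1) = (s + \<Theta>) ^ (q + 1)"
    unfolding g_eq by (rule minus_power_Suc_card)
  thus ?thesis using nz s by (simp add: power_mult_distrib field_simps)
qed

text \<open>The \<open>\<tau>^3\<close> coefficient of the commutation relation determines
  \<open>d'\<close> and the \<open>\<tau>\<close> coefficient determines \<open>g'\<close>; the
  scalar \<open>a\<close> then cancels.\<close>

lemma j_target: "g' ^ (q + 1) / d' = (\<Theta> ^ q + s) ^ (q + 1) / s ^ q"
proof -
  define r where "r = x ^ (q - 1)"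
  have r: "r \<noteq> 0" using nz by (simp add: r_def)
  have e1: "a * d ^ q = d' * a ^ (q ^ 2)"
    and e2: "a * (\<Theta> ^ q - r * g) = \<Theta> * a - g' * (a * r) ^ q"
    using comm unfolding commute_iff r_def by auto
  have "d' \<noteq> 0" using e1 nz by auto
  have d': "d' = a * d ^ q / a ^ (q ^ 2)" using e1 nz by (simp add: field_simps)
  have "g' * (a * r) ^ q = - (a * (\<Theta> ^ q + s))"
    using e2 unfolding g_eq[folded r_def] by (subst eq_neg_iff_add_eq_0) (simp add: algebra_simps)
  hence "(g' * (a * r) ^ q) ^ (q + 1) = (a * (\<Theta> ^ q + s)) ^ (q + 1)"
    by (simp only: minus_power_Suc_card)
  hence "g' ^ (q + 1) * (a ^ (q * (q + 1)) * r ^ (q * (q + 1))) = a ^ (q + 1) * (\<Theta> ^ q + s) ^ (q + 1)"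
    unfolding power_mult_distrib power_mult[symmetric] by (simp only: mult_ac)
  hence "g' ^ (q + 1) = a ^ (q + 1) * (\<Theta> ^ q + s) ^ (q + 1) / (a ^ (q * (q + 1)) * r ^ (q * (q + 1)))"
    using nz r by (simp add: field_simps)
  moreover have "a ^ (q * (q + 1)) * (a * d ^ q) = a ^ (q + 1) * (a ^ (q ^ 2) * d ^ q)"
    by (simp add: power_add power2_eq_square algebra_simps)
  moreover have "s ^ q = d ^ q * r ^ (q * (q + 1))"
    unfolding s r_def[symmetric] power_mult_distrib power_mult[symmetric] by (simp only: mult_ac)
  ultimately show ?thesis
    unfolding d' using nz r by (simp add: divide_simps) algebra
qed

text \<open>\<open>z\<close> is a \<open>T\<close>-division point of \<open>x\<close>, and its image
  \<open>x'\<close> spans the kernel of the next step.\<close>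

context
  fixes z x' y
  assumes z: "poly (rank2_poly g d) z = x" and x': "x' = poly (Polynomial.smult a (line_poly x)) z" "x' \<noteq> 0"
    and y: "y = (z / x) ^ q - z / x"
begin

lemma x'_eq: "x' = a * x ^ q * y"
proof -
  define c where "c = z / x"
  have zc: "z = c * x" using nz by (simp add: c_def)
  have "x ^ (q - 1) * z = c * x ^ q"
    unfolding zc by (simp only: power_q_pred[symmetric] mult_ac)
  hence "x' = a * (z ^ q - c * x ^ q)" by (simp only: x' poly_smult poly_line)
  also have "z ^ q = c ^ q * x ^ q" by (simp only: zc power_mult_distrib)
  finally show ?thesis unfolding y c_def[symmetric] by (simp add: algebra_simps)
qed

lemma y_nonzero: "y \<noteq> 0" using x' x'_eq by auto

text \<open>Put \<open>c = z / x\<close> and divide the equation for \<open>z\<close> by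
  \<open>x\<close>. After \<open>g_eq\<close> the terms group into \<open>s\<close> times
  \<open>c ^ (q ^ 2) - c ^ q = y ^ q\<close> and \<open>\<Theta>\<close> times
  \<open>c ^ q - c = y\<close>.\<close>

lemma s_y: "s * y ^ q = 1 + \<Theta> * y"
proof -
  define c where "c = z / x"
  have zc: "z = c * x" using nz by (simp add: c_def)
  have "x = \<Theta> * (c * x) + g * (x ^ (q - 1) * x) * c ^ q + d * ((x ^ (q - 1)) ^ (q + 1) * x) * c ^ (q ^ 2)"
    using z unfolding zc poly_rank2 power_mult_distrib power_q2[of x, symmetric] power_q_pred
    by (simp add: mult_ac)
  also have "\<dots> = (\<Theta> * c + (x ^ (q - 1) * g) * c ^ q + s * c ^ (q ^ 2)) * x"
    unfolding s by (simp add: algebra_simps)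
  finally have "\<Theta> * c + (x ^ (q - 1) * g) * c ^ q + s * c ^ (q ^ 2) = 1"
    using nz by simp
  moreover have "y ^ q = c ^ (q ^ 2) - c ^ q"
    unfolding y c_def[symmetric] diff_power_card by (simp add: power2_eq_square power_mult)
  ultimately have "s * y ^ q = 1 + \<Theta> * (c ^ q - c)"
    unfolding g_eq by (simp only:) (simp add: algebra_simps)
  thus ?thesis by (simp only: y c_def[symmetric])
qed

lemma one_plus_nonzero: "1 + \<Theta> * y \<noteq> 0"
  using s_y s_nonzero y_nonzero by (metis mult_eq_0_iff power_not_zero)

lemma next_s: "d' * (x' ^ (q - 1)) ^ (q + 1) = (1 + \<Theta> * y) ^ q / y"
proof -
  have e1: "a * d ^ q = d' * a ^ (q ^ 2)" using comm unfolding commute_iff by auto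
  \<comment> \<open>The multiplicative map \<open>N\<close> raises to the power
    \<open>q ^ 2 - 1\<close>. With \<open>x' = a * x ^ q * y\<close> and
    \<open>d ^ q = d' * N a\<close> it turns \<open>d' * N x' * y\<close> into
    \<open>(s * y ^ q) ^ q\<close>.\<close>
  define N where "N = (\<lambda>t :: 'k. (t ^ (q - 1)) ^ (q + 1))"
  have N: "N (t * t') = N t * N t'" "N (t ^ q) = N t ^ q" for t t'
    by (simp_all add: N_def power_mult_distrib power_mult[symmetric] mult_ac)
  have N2: "t ^ (q ^ 2) = N t * t" for t unfolding N_def by (rule power_q2)
  have "a * d ^ q = d' * N a * a" using e1 N2[of a] by (simp add: mult_ac)
  hence "d ^ q = d' * N a" using nz by simp
  hence "d' * N x' * y = (d * N x) ^ q * (N y * y)"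
    unfolding x'_eq N power_mult_distrib by (simp add: mult_ac)
  also have "\<dots> = (s * y ^ q) ^ q"
  proof -
    have "y ^ (q ^ 2) = (y ^ q) ^ q" by (simp add: power2_eq_square power_mult)
    thus ?thesis unfolding N2[symmetric] s N_def[symmetric] by (simp only: power_mult_distrib N_def)
  qed
  finally show ?thesis unfolding s_y N_def using y_nonzero by (simp add: field_simps)
qed

end

end

text \<open>The \<open>\<tau>^3\<close> and \<open>\<tau>\<close> coefficients dictate
  \<open>d' = d ^ q\<close> and \<open>g'\<close>; the \<open>\<tau>^2\<close> coefficient then
  matches because \<open>x\<close> is a \<open>T\<close>-torsion point.\<close>

lemma commute_quotient:
  assumes "x \<noteq> 0" "poly (rank2_poly g d) x = 0"
  shows "\<exists>g' d'. pcompose (line_poly x) (rank2_poly g d) = pcompose (rank2_poly g' d') (line_poly x)"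
proof -
  define r where "r = x ^ (q - 1)"
  define s where "s = d * r ^ (q + 1)"
  have r: "r \<noteq> 0" using assms by (simp add: r_def)
  have rg: "r * g = - (s + \<Theta>)"
  proof -
    have "(\<Theta> + r * g + s) * x = poly (rank2_poly g d) x"
      unfolding poly_rank2 power_q2 s_def r_def power_q_pred[symmetric, of x] by (simp add: algebra_simps)
    hence "\<Theta> + r * g + s = 0" using assms by simp
    thus ?thesis by (subst eq_neg_iff_add_eq_0) (simp only: add_ac)
  qed
  define g' where "g' = - (\<Theta> ^ q + s) / r ^ q"
  have "r ^ q * g ^ q = - (s ^ q + \<Theta> ^ q)"
    using arg_cong[OF rg, of "\<lambda>t. t ^ q"] by (simp only: power_mult_distrib minus_power_card add_power_card)
  moreover have "s ^ q = d ^ q * (r ^ (q ^ 2) * r ^ q)"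
    by (simp add: s_def power_mult_distrib power_add power2_eq_square power_mult mult_ac)
  moreover have "r ^ q * (r * d) = s" by (simp add: s_def)
  moreover have "r ^ q * g' = - (\<Theta> ^ q + s)" using r by (simp add: g'_def)
  ultimately have "r ^ q * (g ^ q - r * d) = r ^ q * (g' - d ^ q * r ^ (q ^ 2))"
    by (simp add: right_diff_distrib mult_ac)
  hence "g ^ q - r * d = g' - d ^ q * r ^ (q ^ 2)" using r by simp
  moreover have "\<Theta> ^ q - r * g = \<Theta> - g' * r ^ q"
    using r by (simp add: rg g'_def)
  ultimately show ?thesis
    using commute_iff[of 1 x g d g' "d ^ q"] by (auto simp: r_def)
qed

end

section \<open>Isogenies and torsion points\<close>

lemma pcompose_power: "pcompose (p ^ n) r = pcompose p r ^ n"
  for p r :: "'a::comm_semiring_1 poly"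
  by (induction n) (simp_all add: pcompose_1 pcompose_mult)

lemma T_dvd_iff: "T_elem dvd a \<longleftrightarrow> poly a 0 = (0 :: 'q::field)"
  using poly_eq_0_iff_dvd[of a 0] by simp

lemma T_square_dvd_iff: "T_elem ^ 2 dvd pCons c (pCons d b) \<longleftrightarrow> c = 0 \<and> d = (0 :: 'q::field)"
proof
  assume "T_elem ^ 2 dvd pCons c (pCons d b)"
  then obtain r where "pCons c (pCons d b) = T_elem ^ 2 * r" by (rule dvdE)
  thus "c = 0 \<and> d = 0" by (simp add: power2_eq_square)
next
  assume "c = 0 \<and> d = 0"
  hence "pCons c (pCons d b) = T_elem ^ 2 * b" by (simp add: power2_eq_square)
  thus "T_elem ^ 2 dvd pCons c (pCons d b)" by simp
qed

context constant_field_embedding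
begin

lemma drinfeld_T_poly:
  assumes "drinfeld_module_rank2 \<iota> \<phi>"
  shows "\<phi> T_elem = rank2_poly (drinfeld_g \<phi>) (drinfeld_Delta \<phi>)" "drinfeld_Delta \<phi> \<noteq> 0"
proof -
  have lin: "linearized q (\<phi> T_elem)" and c1: "poly.coeff (\<phi> T_elem) 1 = \<Theta>"
    and deg: "Polynomial.degree (\<phi> T_elem) = q ^ 2"
    using assms by (simp_all only: drinfeld_module_rank2_def q_card \<Theta>_def)
  show "\<phi> T_elem = rank2_poly (drinfeld_g \<phi>) (drinfeld_Delta \<phi>)"
  proof (rule poly_eqI)
    fix n
    consider "n = 1" | "n = q" | "n = q ^ 2" | "n \<noteq> 1" "n \<noteq> q" "n \<noteq> q ^ 2" by blast
    thus "poly.coeff (\<phi> T_elem) n = poly.coeff (rank2_poly (drinfeld_g \<phi>) (drinfeld_Delta \<phi>)) n"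
    proof cases
      case 4
      have "poly.coeff (\<phi> T_elem) n = 0"
      proof (rule ccontr)
        assume nz: "poly.coeff (\<phi> T_elem) n \<noteq> 0"
        then obtain k where k: "n = q ^ k" using lin by (auto simp: linearized_def)
        have "q ^ k \<le> q ^ 2" using le_degree[OF nz] deg k by simp
        hence "k \<le> 2" using q_ge_2 power_le_imp_le_exp[of q k 2] by simp
        hence "k = 0 \<or> k = 1 \<or> k = 2" by auto
        thus False using 4 k by auto
      qed
      thus ?thesis using 4 by (simp add: rank2_poly_def)
    qed (use q_exponents(7) q_exponents(1-6)[THEN not_sym] q_exponents(1-6) c1 in \<open>simp_all add: rank2_poly_def drinfeld_g_def drinfeld_Delta_def q_card[symmetric]\<close>)
  qed
  show "drinfeld_Delta \<phi> \<noteq> 0"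
    using deg q_exponents(7) unfolding drinfeld_Delta_def q_card[symmetric]
    by (metis degree_0 leading_coeff_0_iff power_not_zero less_numeral_extra(3))
qed

lemma drinfeld_act:
  assumes "drinfeld_module_rank2 \<iota> \<phi>"
  shows "poly (\<phi> (a + b)) x = poly (\<phi> a) x + poly (\<phi> b) x"
    and "poly (\<phi> (a * b)) x = poly (\<phi> a) (poly (\<phi> b) x)"
    and "poly (\<phi> [:c:]) x = h c * x"
    and "poly (\<phi> a) 0 = 0"
    and "poly (\<phi> 1) x = x"
proof -
  show "poly (\<phi> (a + b)) x = poly (\<phi> a) x + poly (\<phi> b) x"
    "poly (\<phi> (a * b)) x = poly (\<phi> a) (poly (\<phi> b) x)"
    using assms by (simp_all add: drinfeld_module_rank2_def poly_pcompose)
  show const: "poly (\<phi> [:c:]) x = h c * x" for c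
    using assms by (simp add: drinfeld_module_rank2_def h_def)
  show "poly (\<phi> 1) x = x" using const[of 1] by (simp add: h_1 one_pCons)
  have "poly.coeff (\<phi> a) 0 = 0"
    using assms unfolding drinfeld_module_rank2_def linearized_def by fastforce
  thus "poly (\<phi> a) 0 = 0" by (simp add: poly_0_coeff_0)
qed

lemma drinfeld_act_pCons:
  assumes "drinfeld_module_rank2 \<iota> \<phi>"
  shows "poly (\<phi> (pCons c b)) x = h c * x + poly (\<phi> b) (poly (\<phi> T_elem) x)"
proof -
  have "pCons c b = [:c:] + b * T_elem" by simp
  thus ?thesis using drinfeld_act[OF assms] by metis
qed

lemma isogeny_act:
  assumes "isogeny \<phi> \<psi> u"
  shows "poly u (poly (\<phi> a) x) = poly (\<psi> a) (poly u x)"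
  using assms by (metis isogeny_def poly_pcompose)

text \<open>Comparing the lowest terms \<open>c\<tau>\<^sup>k\<close> in \<open>u\<phi>\<^sub>T = \<psi>\<^sub>T u\<close> gives \<open>T\<^bsup>q^k\<^esup> = T\<close>.\<close>

lemma isogeny_separable:
  assumes "drinfeld_module_rank2 \<iota> \<phi>" "drinfeld_module_rank2 \<iota> \<psi>" and u: "isogeny \<phi> \<psi> u"
  shows "poly.coeff u 1 \<noteq> 0"
proof -
  \<comment> \<open>\<open>n\<close> is the lowest exponent in \<open>u\<close>. Cancelling
    \<open>X ^ n\<close> in the commutation relation and evaluating at 0 compares the lowest
    coefficients.\<close>
  define n where "n = order 0 u"
  have u0: "u \<noteq> 0" and lin: "linearized q u"
    and comm: "pcompose u (\<phi> T_elem) = pcompose (\<psi> T_elem) u"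
    using u by (simp_all add: isogeny_def q_card)
  obtain w where w: "u = [:- 0, 1:] ^ n * w" "\<not> [:- 0, 1:] dvd w"
    using order_decomp[OF u0, of 0] unfolding n_def by blast
  have w0: "poly w 0 \<noteq> 0" using w(2) poly_eq_0_iff_dvd by blast
  have T_factor: "\<exists>m. \<chi> T_elem = T_elem * m \<and> poly m 0 = \<Theta>" if "drinfeld_module_rank2 \<iota> \<chi>" for \<chi>
  proof -
    have "poly (\<chi> T_elem) 0 = 0" by (rule drinfeld_act[OF that])
    then obtain m where m: "\<chi> T_elem = [:- 0, 1:] * m" using poly_eq_0_iff_dvd by (metis dvdE)
    have "poly.coeff (\<chi> T_elem) 1 = \<Theta>" using that by (simp add: drinfeld_module_rank2_def \<Theta>_def)
    thus ?thesis using m by (intro exI[of _ m]) (simp add: poly_0_coeff_0)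
  qed
  obtain m m' where m: "\<phi> T_elem = T_elem * m" "poly m 0 = \<Theta>"
    and m': "\<psi> T_elem = T_elem * m'" "poly m' 0 = \<Theta>"
    using T_factor assms(1,2) by metis
  have un: "poly.coeff u n = poly w 0"
    unfolding w(1) by (simp add: monom_altdef[of 1, simplified, symmetric] coeff_monom_mult poly_0_coeff_0)
  then obtain k where k: "n = q ^ k" using lin[unfolded linearized_def, rule_format, of n] w0 by auto
  hence "n > 0" using q_exponents(7) by simp
  hence "poly u 0 = 0" unfolding w(1) by simp
  have pu: "pcompose T_elem (p :: 'k poly) = p" for p by (simp add: pcompose_pCons)
  have "T_elem ^ n * (m ^ n * pcompose w (\<phi> T_elem)) = \<phi> T_elem ^ n * pcompose w (\<phi> T_elem)"
    by (simp only: m(1) power_mult_distrib mult.assoc)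
  also have "\<dots> = pcompose u (\<phi> T_elem)"
    by (subst w(1)) (simp add: pcompose_mult pcompose_power pu)
  also have "\<dots> = u * pcompose m' u"
    unfolding comm m'(1) by (simp only: pcompose_mult pu)
  also have "\<dots> = T_elem ^ n * (w * pcompose m' u)"
    by (subst w(1)) (simp add: mult_ac)
  finally have "m ^ n * pcompose w (\<phi> T_elem) = w * pcompose m' u" by simp
  hence "poly (m ^ n * pcompose w (\<phi> T_elem)) 0 = poly (w * pcompose m' u) 0" by simp
  hence "\<Theta> ^ n * poly w 0 = poly w 0 * \<Theta>"
    by (simp add: poly_pcompose m(2) m'(2) \<open>poly u 0 = 0\<close> drinfeld_act(4)[OF assms(1)])
  hence "\<Theta> ^ n = \<Theta>" using w0 by simp
  hence "n = 1" by (rule \<Theta>_power_eq_imp)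
  thus ?thesis using un w0 by simp
qed

lemma isogeny_eq_smult:
  assumes "drinfeld_module_rank2 \<iota> \<phi>" "drinfeld_module_rank2 \<iota> \<psi>" "isogeny \<phi> \<psi> u"
    and "card {x. poly u x = 0} = n" "poly.coeff m n = 1" "Polynomial.degree m \<le> n"
    and "\<And>x. poly u x = 0 \<Longrightarrow> poly m x = 0"
  shows "\<exists>a. a \<noteq> 0 \<and> u = Polynomial.smult a m"
proof -
  have "pderiv u = [:poly.coeff u 1:]"
    using assms(3) by (intro pderiv_linearized) (auto simp: isogeny_def linearized_def q_card)
  hence "u = Polynomial.smult (poly.coeff u (Polynomial.degree u)) m"
    using assms isogeny_separable[OF assms(1-3)]
    by (intro eq_smult_of_simple_roots[of u "poly.coeff u 1"]) auto
  moreover have "u \<noteq> 0" using assms(3) by (simp add: isogeny_def)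
  ultimately show ?thesis by (metis leading_coeff_0_iff)
qed

text \<open>The generator is the image of 1 under the parametrization of the kernel.\<close>

lemma N_isogeny_generator:
  assumes "N_isogeny N \<phi> \<psi> u"
  obtains g where "\<And>x. poly u x = 0 \<longleftrightarrow> (\<exists>a. x = poly (\<phi> a) g)"
    and "\<And>a. poly (\<phi> a) g = 0 \<longleftrightarrow> N dvd a"
proof -
  obtain f where f: "module_hom (*) (\<lambda>a x. poly (\<phi> a) x) f" "range f = {x. poly u x = 0}"
      "{a. f a = 0} = {a. N dvd a}"
    using assms by (auto simp: N_isogeny_def)
  have fa: "f a = poly (\<phi> a) (f 1)" for a
    using module_hom.scale[OF f(1), of a 1] by simp
  have "poly u x = 0 \<longleftrightarrow> (\<exists>a. x = poly (\<phi> a) (f 1))" for x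
    using f(2) fa by (metis (mono_tags, lifting) mem_Collect_eq rangeE rangeI)
  moreover have "poly (\<phi> a) (f 1) = 0 \<longleftrightarrow> N dvd a" for a
    using f(3) fa by (metis (mono_tags, lifting) mem_Collect_eq)
  ultimately show ?thesis using that by blast
qed

text \<open>A kernel isomorphic to \<open>A/(T)\<close> is a line over the finite field, spanned by
  any of its nonzero points, and a separable isogeny is determined by its kernel up to a
  scalar.\<close>

lemma T_isogeny_eq_line:
  assumes mod: "drinfeld_module_rank2 \<iota> \<phi>" "drinfeld_module_rank2 \<iota> \<psi>"
    and v: "N_isogeny T_elem \<phi> \<psi> v" and x: "x \<noteq> 0" "poly v x = 0"
  shows "\<exists>a. a \<noteq> 0 \<and> v = Polynomial.smult a (line_poly x)"
proof -
  obtain g where g: "\<And>x. poly v x = 0 \<longleftrightarrow> (\<exists>a. x = poly (\<phi> a) g)"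
      "\<And>a. poly (\<phi> a) g = 0 \<longleftrightarrow> T_elem dvd a"
    using N_isogeny_generator[OF v] by blast
  have Tg: "poly (\<phi> T_elem) g = 0" by (subst g(2)) simp
  have act: "poly (\<phi> (pCons c b)) g = h c * g" for c b
    using drinfeld_act_pCons[OF mod(1), of c b g] Tg drinfeld_act(4)[OF mod(1)] by simp
  have ker_g: "poly v y = 0 \<longleftrightarrow> (\<exists>c. y = h c * g)" for y
    unfolding g(1) using act by (metis pCons_cases)
  then obtain c where c: "x = h c * g" using x by auto
  have c0: "c \<noteq> 0" using c x h_0 by auto
  have g_eq: "g = h (inverse c) * x"
    using c c0 h_mult[of "inverse c" c] h_1 by (simp add: mult.assoc[symmetric])
  have ker: "{y. poly v y = 0} = (\<lambda>d. h d * x) ` UNIV"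
  proof (intro subset_antisym subsetI)
    fix y assume "y \<in> {y. poly v y = 0}"
    then obtain d where "y = h d * g" using ker_g by auto
    hence "y = h (d * inverse c) * x" by (simp add: g_eq h_mult mult_ac)
    thus "y \<in> (\<lambda>d. h d * x) ` UNIV" by blast
  next
    fix y assume "y \<in> (\<lambda>d. h d * x) ` UNIV"
    then obtain d where "y = h (d * c) * g" by (auto simp: c h_mult mult_ac)
    thus "y \<in> {y. poly v y = 0}" using ker_g by blast
  qed
  have "card {y. poly v y = 0} = q"
    unfolding ker q_card by (rule card_image) (use x in \<open>auto simp: inj_on_def h_eq_iff\<close>)
  moreover have "poly (line_poly x) y = 0" if "poly v y = 0" for y
  proof -
    have "y \<in> (\<lambda>d. h d * x) ` UNIV" using that ker by blast
    then obtain d where "y = h d * x" by blast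
    thus ?thesis by (simp only: poly_line_h poly_line_self mult_zero_right)
  qed
  ultimately show ?thesis
    using v lead_coeff_line degree_line
    by (intro isogeny_eq_smult[OF mod]) (auto simp: N_isogeny_def)
qed

end

locale isogeny_tower = constant_field_embedding \<iota> q
  for \<iota> :: "'q::{field,finite} poly fract \<Rightarrow> 'k::alg_closed_field" and q +
  fixes \<phi> :: "'q poly \<Rightarrow> 'k poly" and \<psi> :: "nat \<Rightarrow> 'q poly \<Rightarrow> 'k poly"
    and u v :: "nat \<Rightarrow> 'k poly"
  assumes \<phi>: "drinfeld_module_rank2 \<iota> \<phi>" and \<psi>: "drinfeld_module_rank2 \<iota> (\<psi> n)"
    and u: "N_isogeny (T_elem ^ (n + 2)) \<phi> (\<psi> n) (u n)"
    and v: "N_isogeny T_elem (\<psi> n) (\<psi> (n + 1)) (v n)"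
    and projection: "u (n + 1) = pcompose (v n) (u n)"
begin

abbreviation act :: "'q poly \<Rightarrow> 'k \<Rightarrow> 'k" where "act a \<equiv> poly (\<phi> a)"

lemmas act_simps = drinfeld_act[OF \<phi>]

text \<open>The kernel generators \<open>G n\<close> are multiplied by polynomials prime to
  \<open>T\<close> until they form a chain of division points; \<open>Z n\<close> has exact order
  \<open>T ^ (n + 1)\<close>.\<close>

lemma torsion_points:
  obtains Z where "act T_elem (Z 0) = 0" "\<And>n. act T_elem (Z (Suc n)) = Z n"
    and "\<And>n. poly (u n) (Z (Suc n)) = 0" "\<And>n. poly (u n) (Z (Suc (Suc n))) \<noteq> 0"
    and "\<And>x. poly (u 0) x = 0 \<longleftrightarrow> (\<exists>c d. x = h c * Z 1 + h d * Z 0)"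
    and "\<And>c d. h c * Z 1 + h d * Z 0 = 0 \<Longrightarrow> c = 0 \<and> d = 0"
proof -
  have "\<exists>g. (\<forall>x. poly (u n) x = 0 \<longleftrightarrow> (\<exists>a. x = act a g)) \<and> (\<forall>a. act a g = 0 \<longleftrightarrow> T_elem ^ (n + 2) dvd a)" for n
    using N_isogeny_generator[OF u, of n] by metis
  then obtain G where G: "\<And>n x. poly (u n) x = 0 \<longleftrightarrow> (\<exists>a. x = act a (G n))"
      "\<And>n a. act a (G n) = 0 \<longleftrightarrow> T_elem ^ (n + 2) dvd a" by metis
  \<comment> \<open>The kernel of \<open>u n\<close> lies in that of \<open>u (Suc n)\<close>, so
    \<open>G n\<close> is a multiple of \<open>G (Suc n)\<close>. Comparing the orders shows that
    the factor is divisible by \<open>T\<close> exactly once.\<close>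
  have "\<exists>b. G n = act (T_elem * b) (G (Suc n)) \<and> poly b 0 \<noteq> 0" for n
  proof -
    have "poly (u n) (G n) = 0" unfolding G(1) using act_simps(5)[of "G n"] by metis
    hence "poly (u (Suc n)) (G n) = 0"
      using projection[of n] v[of n] isogeny_act[of "\<psi> n" "\<psi> (n + 1)" "v n" 0 0]
        drinfeld_act(4)[OF \<psi>] drinfeld_act(3)[OF \<psi>, of "Suc n" 0] h_0
      by (simp add: poly_pcompose N_isogeny_def)
    then obtain a where a: "G n = act a (G (Suc n))" using G(1) by blast
    have T_pow: "(T_elem :: 'q poly) ^ k * a dvd T_elem ^ k * b \<longleftrightarrow> a dvd b" for k and a b :: "'q poly"
      by simp
    have "act (T_elem ^ (n + 2) * a) (G (Suc n)) = 0"
      using G(2)[of "T_elem ^ (n + 2)" n] by (simp only: act_simps(2) a[symmetric]) simp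
    hence "T_elem ^ (n + 2) * T_elem dvd T_elem ^ (n + 2) * a"
      by (simp only: G(2)) (simp add: mult_ac)
    hence "T_elem dvd a" by (simp only: T_pow)
    then obtain b where b: "a = T_elem * b" by (rule dvdE)
    have "poly b 0 \<noteq> 0"
    proof
      assume "poly b 0 = 0"
      hence "T_elem dvd b" by (simp only: T_dvd_iff)
      hence "T_elem ^ (n + 2) * T_elem dvd T_elem ^ (n + 2) * b" by (simp only: T_pow)
      hence "T_elem ^ (Suc n + 2) dvd T_elem ^ (n + 1) * a"
        by (simp add: b mult_ac)
      hence "act (T_elem ^ (n + 1)) (G n) = 0"
        unfolding a act_simps(2)[symmetric] G(2) .
      hence "(T_elem :: 'q poly) ^ (n + 2) dvd T_elem ^ (n + 1)" by (simp only: G(2))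
      hence "Polynomial.degree ((T_elem :: 'q poly) ^ (n + 2)) \<le> Polynomial.degree ((T_elem :: 'q poly) ^ (n + 1))"
        by (intro dvd_imp_degree_le) auto
      thus False by (simp only: degree_linear_power)
    qed
    thus ?thesis using a b by blast
  qed
  then obtain b where b: "\<And>n. G n = act (T_elem * b n) (G (Suc n))" "\<And>n. poly (b n) 0 \<noteq> 0" by metis
  \<comment> \<open>The product of the cofactors \<open>b\<close> below \<open>n\<close>; it absorbs
    them, so that \<open>T\<close> sends \<open>e (Suc n)\<close> times \<open>G (Suc n)\<close> to
    \<open>e n\<close> times \<open>G n\<close>.\<close>
  define e where "e = rec_nat 1 (\<lambda>n r. r * b n)"
  have e: "e 0 = 1" "e (Suc n) = e n * b n" for n by (simp_all add: e_def)
  have e0: "poly (e n) 0 \<noteq> 0" for n by (induction n) (simp_all add: e b)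
  define Z where "Z = case_nat (act T_elem (G 0)) (\<lambda>n. act (e n) (G n))"
  have Z: "Z 0 = act T_elem (G 0)" "Z (Suc n) = act (e n) (G n)" for n by (simp_all add: Z_def)
  have Z1: "Z 1 = G 0" using Z(2)[of 0] by (simp add: e act_simps)
  have ZT: "act T_elem (Z (Suc n)) = Z n" for n
  proof (cases n)
    case (Suc m)
    have "T_elem * (e m * b m) = e m * (T_elem * b m)" by (simp only: mult_ac)
    thus ?thesis unfolding Suc Z e act_simps(2)[symmetric] by (simp only: act_simps(2) b(1)[of m])
  qed (simp add: Z e act_simps)
  have comb: "h c * Z 1 + h d * Z 0 = act [:c, d:] (G 0)" for c d
    unfolding Z1 drinfeld_act_pCons[OF \<phi>, of c] act_simps(3) Z(1) ..
  show ?thesis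
  proof (rule that)
    show "act T_elem (Z 0) = 0"
      unfolding Z act_simps(2)[symmetric] G(2) by (simp only: power2_eq_square add_0 dvd_refl)
    show "act T_elem (Z (Suc n)) = Z n" for n by (rule ZT)
    show "poly (u n) (Z (Suc n)) = 0" for n unfolding G(1) Z by blast
    show "poly (u n) (Z (Suc (Suc n))) \<noteq> 0" for n
    proof
      assume "poly (u n) (Z (Suc (Suc n))) = 0"
      then obtain a where "act (e (Suc n)) (G (Suc n)) = act a (G n)" unfolding G(1) Z by blast
      hence eq: "act (e (Suc n)) (G (Suc n)) = act (a * (T_elem * b n)) (G (Suc n))"
        by (simp only: act_simps(2) b(1)[of n])
      \<comment> \<open>The difference annihilates \<open>G (Suc n)\<close>, so \<open>T\<close>
        divides it and hence also \<open>e (Suc n)\<close>, which is prime to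
        \<open>T\<close>.\<close>
      have "act (e (Suc n) + [:-1:] * (a * (T_elem * b n))) (G (Suc n)) = 0"
        unfolding act_simps(1) act_simps(2)[of "[:-1:]"] eq[symmetric] act_simps(3)
        using h_diff[of 0 1] by (simp add: h_0 h_1)
      hence "(T_elem :: 'q poly) ^ (Suc n + 2) dvd e (Suc n) + [:-1:] * (a * (T_elem * b n))"
        by (simp only: G(2))
      hence "T_elem dvd e (Suc n) + [:-1:] * (a * (T_elem * b n))"
        by (rule dvd_trans[rotated]) (rule dvd_power, simp)
      hence "poly (e (Suc n)) 0 = 0" by (simp only: T_dvd_iff) simp
      thus False using e0 by blast
    qed
    show "poly (u 0) x = 0 \<longleftrightarrow> (\<exists>c d. x = h c * Z 1 + h d * Z 0)" for x
    proof -
      have "\<exists>c d. act a (G 0) = act [:c, d:] (G 0)" for a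
      proof -
        obtain c d r where a: "a = pCons c (pCons d r)" by (metis pCons_cases)
        have "a = [:c, d:] + r * T_elem ^ 2" by (simp add: a power2_eq_square)
        moreover have "act (T_elem ^ 2) (G 0) = 0" by (simp only: G(2) add_0 dvd_refl)
        ultimately have "act a (G 0) = act [:c, d:] (G 0)"
          by (simp only: act_simps(1,2,4)) simp
        thus ?thesis by blast
      qed
      thus ?thesis unfolding G(1) comb by metis
    qed
    show "c = 0 \<and> d = 0" if "h c * Z 1 + h d * Z 0 = 0" for c d
      using that unfolding comb G(2) add_0 T_square_dvd_iff .
  qed
qed

end

section \<open>The chain of isogenies and its parameters\<close>

text \<open>The Moebius substitution has the inverse \<open>w = - 1 / (1 + \<xi>)\<close>.\<close>

lemma adjoin_moebius:
  assumes "w \<noteq> (0 :: 'a::field)"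
  shows "adjoin K {w} = adjoin K {- (1 + w) / w}"
proof -
  define \<xi> where "\<xi> = - (1 + w) / w"
  interpret A: subfield_set "adjoin K {w}" by (rule subfield_set_adjoin)
  interpret B: subfield_set "adjoin K {\<xi>}" by (rule subfield_set_adjoin)
  have incl: "K \<subseteq> adjoin K {w}" "w \<in> adjoin K {w}" "K \<subseteq> adjoin K {\<xi>}" "\<xi> \<in> adjoin K {\<xi>}"
    using adjoin_incl[of K "{w}"] adjoin_incl[of K "{\<xi>}"] by auto
  have "w = - 1 / (1 + \<xi>)" using assms by (simp add: \<xi>_def field_simps)
  hence "w \<in> adjoin K {\<xi>}" using incl by (auto intro: B.mem_intros)
  hence "adjoin K {w} \<subseteq> adjoin K {\<xi>}"
    using incl by (intro adjoin_least subfield_set_adjoin) auto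
  moreover have "- (1 + w) / w \<in> adjoin K {w}" using incl by (intro A.mem_intros)
  hence "adjoin K {\<xi>} \<subseteq> adjoin K {w}"
    using incl by (intro adjoin_least subfield_set_adjoin) (auto simp: \<xi>_def)
  ultimately show ?thesis unfolding \<xi>_def by (rule subset_antisym)
qed

context isogeny_tower
begin

lemma u_commute: "pcompose (u n) (\<phi> a) = pcompose (\<psi> n a) (u n)"
  using u[of n] by (simp add: N_isogeny_def isogeny_def)

lemma v_commute: "pcompose (v n) (\<psi> n a) = pcompose (\<psi> (Suc n) a) (v n)"
  using v[of n] by (simp add: N_isogeny_def isogeny_def)

lemma u_act: "poly (u n) (act a t) = poly (\<psi> n a) (poly (u n) t)"
  using u_commute by (metis poly_pcompose)

text \<open>The kernel of \<open>u 0\<close> is a plane. Dividing by the line through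
  \<open>z0\<close> and then by the line through the image \<open>x1\<close> of \<open>z1\<close>
  gives a monic polynomial of degree \<open>q ^ 2\<close> that kills the plane.\<close>

lemma u_0_decomp:
  assumes ker: "\<And>x. poly (u 0) x = 0 \<longleftrightarrow> (\<exists>c d. x = h c * z1 + h d * z0)"
    and indep: "\<And>c d. h c * z1 + h d * z0 = 0 \<Longrightarrow> c = 0 \<and> d = 0"
  defines "x1 \<equiv> poly (line_poly z0) z1"
  obtains a where "a \<noteq> 0" "u 0 = pcompose (Polynomial.smult a (line_poly x1)) (line_poly z0)"
    and "x1 \<noteq> 0"
proof -
  have z0: "z0 \<noteq> 0" using indep[of 0 1] by (auto simp: h_1 h_0)
  \<comment> \<open>Another root would give \<open>line_poly z0\<close>, of degree \<open>q\<close>,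
    at least \<open>q + 1\<close> roots.\<close>
  have root_line: "\<exists>c. t = h c * z0" if "poly (line_poly z0) t = 0" for t
  proof (rule ccontr)
    assume *: "\<nexists>c. t = h c * z0"
    have sub: "insert t (range (\<lambda>c. h c * z0)) \<subseteq> {y. poly (line_poly z0) y = 0}"
      using that by (auto simp: poly_line_h poly_line_self)
    have "card (range (\<lambda>c. h c * z0)) = q"
      unfolding q_card by (rule card_image) (use z0 in \<open>auto simp: inj_on_def h_eq_iff\<close>)
    hence "card (insert t (range (\<lambda>c. h c * z0))) = Suc q"
      using * by (subst card_insert_disjoint) auto
    moreover have nz: "line_poly z0 \<noteq> 0" using degree_line[of z0] q_exponents(7) by auto
    ultimately have "Suc q \<le> card {y. poly (line_poly z0) y = 0}"
      using card_mono[OF poly_roots_finite[OF nz] sub] by simp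
    thus False using card_poly_roots_bound[OF nz] degree_line[of z0] by simp
  qed
  have x1: "x1 \<noteq> 0"
  proof
    assume "x1 = 0"
    then obtain c where "z1 = h c * z0" using root_line by (auto simp: x1_def)
    hence "h 1 * z1 + h (- c) * z0 = 0" using h_diff[of 0 c] by (simp add: h_1 h_0)
    thus False using indep by fastforce
  qed
  define m where "m = pcompose (line_poly x1) (line_poly z0)"
  have deg: "Polynomial.degree m = q ^ 2"
    by (simp add: m_def degree_pcompose degree_line power2_eq_square)
  have lead: "poly.coeff m (q ^ 2) = 1"
    using lead_coeff_comp[of "line_poly z0" "line_poly x1"] lead_coeff_line q_exponents(7)
    unfolding m_def[symmetric] deg degree_line by simp
  have roots: "{x. poly (u 0) x = 0} = (\<lambda>(c, d). h c * z1 + h d * z0) ` UNIV"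
    using ker by (auto simp: image_def)
  have "inj (\<lambda>(c, d). h c * z1 + h d * z0)"
  proof (rule injI, clarify)
    fix c d c' d' assume "h c * z1 + h d * z0 = h c' * z1 + h d' * z0"
    hence "h (c - c') * z1 + h (d - d') * z0 = 0" by (simp add: h_diff algebra_simps)
    thus "c = c' \<and> d = d'" using indep by fastforce
  qed
  hence "card {x. poly (u 0) x = 0} = q ^ 2"
    unfolding roots by (simp add: card_image q_card power2_eq_square card_prod)
  moreover have "poly m t = 0" if "poly (u 0) t = 0" for t
  proof -
    obtain c d where "t = h c * z1 + h d * z0" using ker[of t] \<open>poly (u 0) t = 0\<close> by blast
    hence "poly (line_poly z0) t = h c * x1"
      by (simp only: poly_line_add poly_line_h poly_line_self x1_def mult_zero_right add_0_right)
    thus ?thesis by (simp only: m_def poly_pcompose poly_line_h poly_line_self mult_zero_right)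
  qed
  ultimately obtain a where "a \<noteq> 0" "u 0 = Polynomial.smult a m"
    using isogeny_eq_smult[OF \<phi> \<psi>[of 0], of "u 0" "q ^ 2" m] u[of 0] deg lead
    by (auto simp: N_isogeny_def)
  thus ?thesis using that x1 by (simp add: m_def pcompose_smult)
qed

text \<open>The chain \<open>\<phi> = \<phi>\<^sub>0 \<rightarrow> \<phi>\<^sub>1 \<rightarrow> \<phi>\<^sub>2 = \<psi> 0 \<rightarrow> \<phi>\<^sub>3 = \<psi> 1 \<rightarrow> \<dots>\<close> of \<open>T\<close>-isogenies; \<open>\<phi>\<^sub>i\<close> is given by
  \<open>(g i, d i)\<close>, the \<open>i\<close>-th isogeny by \<open>a i\<close> and a kernel point \<open>x i\<close>, and \<open>z i\<close> is a \<open>T\<close>-division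
  point of \<open>x i\<close>, whose image generates the next kernel since the composites are cyclic.\<close>

definition chain_step :: "'k \<Rightarrow> 'k \<Rightarrow> 'k \<Rightarrow> 'k \<Rightarrow> 'k \<Rightarrow> 'k \<Rightarrow> 'k \<Rightarrow> 'k \<Rightarrow> bool" where
  "chain_step g d a x z g' d' x' \<longleftrightarrow> a \<noteq> 0 \<and> x \<noteq> 0 \<and> d \<noteq> 0 \<and>
     pcompose (Polynomial.smult a (line_poly x)) (rank2_poly g d) =
       pcompose (rank2_poly g' d') (Polynomial.smult a (line_poly x)) \<and>
     poly (rank2_poly g d) x = 0 \<and> poly (rank2_poly g d) z = x \<and>
     x' = poly (Polynomial.smult a (line_poly x)) z \<and> x' \<noteq> 0"

lemma chain_exists:
  obtains g d a x z :: "nat \<Rightarrow> 'k"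
  where "\<And>i. chain_step (g i) (d i) (a i) (x i) (z i) (g (Suc i)) (d (Suc i)) (x (Suc i))"
    and "g 0 = drinfeld_g \<phi>" "d 0 = drinfeld_Delta \<phi>"
    and "\<And>n. g (Suc (Suc n)) = drinfeld_g (\<psi> n)" "\<And>n. d (Suc (Suc n)) = drinfeld_Delta (\<psi> n)"
proof -
  obtain Z where Z0: "act T_elem (Z 0) = 0" and ZT: "\<And>n. act T_elem (Z (Suc n)) = Z n"
    and Zker: "\<And>n. poly (u n) (Z (Suc n)) = 0" and Znot: "\<And>n. poly (u n) (Z (Suc (Suc n))) \<noteq> 0"
    and ker: "\<And>x. poly (u 0) x = 0 \<longleftrightarrow> (\<exists>c d. x = h c * Z 1 + h d * Z 0)"
    and indep: "\<And>c d. h c * Z 1 + h d * Z 0 = 0 \<Longrightarrow> c = 0 \<and> d = 0"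
    using torsion_points by metis
  define g0 d0 where "g0 = drinfeld_g \<phi>" and "d0 = drinfeld_Delta \<phi>"
  define gp dp where "gp = (\<lambda>n. drinfeld_g (\<psi> n))" and "dp = (\<lambda>n. drinfeld_Delta (\<psi> n))"
  have \<phi>T: "\<phi> T_elem = rank2_poly g0 d0" and d0: "d0 \<noteq> 0"
    using drinfeld_T_poly[OF \<phi>] by (simp_all add: g0_def d0_def)
  have \<psi>T: "\<psi> n T_elem = rank2_poly (gp n) (dp n)" and dp: "dp n \<noteq> 0" for n
    using drinfeld_T_poly[OF \<psi>] by (simp_all add: gp_def dp_def)
  have z0: "Z 0 \<noteq> 0" using indep[of 0 1] by (auto simp: h_1 h_0)
  define l where "l = line_poly (Z 0)"
  define x1 where "x1 = poly l (Z 1)"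
  obtain b where b: "b \<noteq> 0" "u 0 = pcompose (Polynomial.smult b (line_poly x1)) l" and x1: "x1 \<noteq> 0"
    using u_0_decomp[OF ker indep] unfolding x1_def l_def by metis
  \<comment> \<open>The intermediate module, the quotient of \<open>\<phi>\<close> by the line
    through \<open>Z 0\<close>.\<close>
  obtain g1 d1 where comm0: "pcompose l (rank2_poly g0 d0) = pcompose (rank2_poly g1 d1) l"
    using commute_quotient[OF z0, of g0 d0] Z0 \<phi>T by (auto simp: l_def)
  have act1: "poly (rank2_poly g1 d1) (poly l t) = poly l (act T_elem t)" for t
    using comm0 \<phi>T by (metis poly_pcompose)
  have d1: "d1 \<noteq> 0"
    using comm0 commute_iff[of 1 "Z 0" g0 d0 g1 d1] d0 by (auto simp: l_def)
  \<comment> \<open>The commutation relation of \<open>u 0\<close> is this one composed with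
    \<open>l\<close> on the right, and the nonconstant \<open>l\<close> can be cancelled.\<close>
  have comm1: "pcompose (Polynomial.smult b (line_poly x1)) (rank2_poly g1 d1) =
      pcompose (rank2_poly (gp 0) (dp 0)) (Polynomial.smult b (line_poly x1))" (is "?L = ?R")
  proof -
    have "pcompose ?L l = pcompose (u 0) (\<phi> T_elem)"
      by (simp only: b(2) \<phi>T comm0[symmetric] pcompose_assoc[symmetric])
    also have "\<dots> = pcompose (\<psi> 0 T_elem) (u 0)" by (rule u_commute)
    also have "\<dots> = pcompose ?R l"
      by (simp only: \<psi>T b(2) pcompose_assoc)
    finally have "pcompose (?L - ?R) l = 0" by (simp only: pcompose_diff diff_self)
    hence "?L - ?R = 0"
      by (rule pcompose_eq_0) (simp add: l_def degree_line q_exponents(7))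
    thus ?thesis by simp
  qed
  define Q where "Q = (\<lambda>n. poly (u n) (Z (Suc (Suc n))))"
  have un: "poly (u (Suc n)) t = poly (v n) (poly (u n) t)" for n t
    using projection[of n] by (simp add: poly_pcompose)
  \<comment> \<open>\<open>Z (n + 2)\<close> is in the kernel of \<open>u (n + 1)\<close> but not of
    \<open>u n\<close>, so its image \<open>Q n\<close> is a nonzero point of the kernel of
    \<open>v n\<close>.\<close>
  have "\<exists>a. a \<noteq> 0 \<and> v n = Polynomial.smult a (line_poly (Q n))" for n
    using v[of n] Znot[of n] un[of n "Z (Suc (Suc n))"] Zker[of "Suc n"]
    by (intro T_isogeny_eq_line[OF \<psi> \<psi>]) (auto simp: Q_def)
  then obtain A where A: "\<And>n. A n \<noteq> 0" "\<And>n. v n = Polynomial.smult (A n) (line_poly (Q n))" by metis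
  \<comment> \<open>Indices 0 and 1 are the two factors of \<open>u 0\<close>; index
    \<open>n + 2\<close> is \<open>v n\<close>.\<close>
  define g where "g = case_nat g0 (case_nat g1 gp)"
  define d where "d = case_nat d0 (case_nat d1 dp)"
  define a where "a = case_nat 1 (case_nat b A)"
  define x where "x = case_nat (Z 0) (case_nat x1 Q)"
  define z where "z = case_nat (Z 1) (case_nat (poly l (Z 2)) (\<lambda>n. poly (u n) (Z (Suc (Suc (Suc n))))))"
  note defs = g_def d_def a_def x_def z_def
  have "chain_step (g i) (d i) (a i) (x i) (z i) (g (Suc i)) (d (Suc i)) (x (Suc i))" for i
  proof -
    consider "i = 0" | "i = 1" | n where "i = Suc (Suc n)"
      by (metis One_nat_def not0_implies_Suc)
    thus ?thesis
    proof cases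
      case 1
      have "act T_elem (Z 1) = Z 0" using ZT[of 0] by simp
      thus ?thesis
        using z0 d0 comm0 Z0 x1 \<phi>T by (simp add: 1 defs chain_step_def l_def x1_def)
    next
      case 2
      have "poly (rank2_poly g1 d1) x1 = 0"
        using ZT[of 0] poly_line_self[of "Z 0"] unfolding l_def[symmetric] by (simp add: x1_def act1)
      moreover have "poly (rank2_poly g1 d1) (poly l (Z 2)) = x1"
        using ZT[of 1] by (simp add: x1_def act1 numeral_2_eq_2)
      moreover have "Q 0 = poly (Polynomial.smult b (line_poly x1)) (poly l (Z 2))"
        by (simp only: Q_def b(2) poly_pcompose numeral_2_eq_2)
      moreover have "Q 0 \<noteq> 0" using Znot by (simp add: Q_def)
      ultimately show ?thesis
        using b(1) x1 d1 comm1 by (simp add: 2 defs chain_step_def)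
    next
      case (3 n)
      have "poly (\<psi> n T_elem) (Q n) = 0"
        unfolding Q_def u_act[symmetric] ZT by (rule Zker)
      moreover have "poly (\<psi> n T_elem) (poly (u n) (Z (Suc (Suc (Suc n))))) = Q n"
        unfolding Q_def u_act[symmetric] ZT ..
      moreover have "Q (Suc n) = poly (v n) (poly (u n) (Z (Suc (Suc (Suc n)))))"
        unfolding Q_def un ..
      moreover have "Q n \<noteq> 0" "Q (Suc n) \<noteq> 0" unfolding Q_def by (rule Znot)+
      moreover have "pcompose (v n) (\<psi> n T_elem) = pcompose (\<psi> (Suc n) T_elem) (v n)"
        by (rule v_commute)
      ultimately show ?thesis
        unfolding 3 defs chain_step_def using A(1)[of n] dp[of n]
        by (auto simp: \<psi>T A(2)[symmetric] simp del: poly_smult)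
    qed
  qed
  moreover have "g 0 = drinfeld_g \<phi>" "d 0 = drinfeld_Delta \<phi>"
    "g (Suc (Suc n)) = drinfeld_g (\<psi> n)" "d (Suc (Suc n)) = drinfeld_Delta (\<psi> n)" for n
    by (simp_all add: defs g0_def d0_def gp_def dp_def)
  ultimately show ?thesis using that by blast
qed

lemma tower_parameters:
  obtains w where "drinfeld_tower (range \<iota>) q \<Theta> w"
    and "drinfeld_tower.j0 q \<Theta> w = j_invariant \<phi>"
    and "\<And>n. drinfeld_tower.j q \<Theta> w n = j_invariant (\<psi> n)"
proof -
  obtain g d a x z where
    step: "\<And>i. chain_step (g i) (d i) (a i) (x i) (z i) (g (Suc i)) (d (Suc i)) (x (Suc i))"
    and gd: "g 0 = drinfeld_g \<phi>" "d 0 = drinfeld_Delta \<phi>"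
      "\<And>n. g (Suc (Suc n)) = drinfeld_g (\<psi> n)" "\<And>n. d (Suc (Suc n)) = drinfeld_Delta (\<psi> n)"
    using chain_exists by blast
  define S where "S = (\<lambda>i. d i * (x i ^ (q - 1)) ^ (q + 1))"
  define y where "y = (\<lambda>i. (z i / x i) ^ q - z i / x i)"
  define w where "w = (\<lambda>i. \<Theta> * y i)"
  note st = step[unfolded chain_step_def]
  have S0: "S i \<noteq> 0" for i
    using st[of i] by (simp add: S_def)
  have src: "g i ^ (q + 1) / d i = (S i + \<Theta>) ^ (q + 1) / S i"
    and tgt: "g (Suc i) ^ (q + 1) / d (Suc i) = (\<Theta> ^ q + S i) ^ (q + 1) / S i ^ q"
    and y0: "y i \<noteq> 0" and Sy: "S i * y i ^ q = 1 + \<Theta> * y i" and one_y: "1 + \<Theta> * y i \<noteq> 0"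
    and S_Suc: "S (Suc i) = (1 + \<Theta> * y i) ^ q / y i" for i
    using st[of i] j_source[of "a i" "x i" "d i" "g i" "g (Suc i)" "d (Suc i)" "S i"]
      j_target[of "a i" "x i" "d i" "g i" "g (Suc i)" "d (Suc i)" "S i"]
      y_nonzero[of "a i" "x i" "d i" "g i" "g (Suc i)" "d (Suc i)" "S i" "z i" "x (Suc i)" "y i"]
      s_y[of "a i" "x i" "d i" "g i" "g (Suc i)" "d (Suc i)" "S i" "z i" "x (Suc i)" "y i"]
      one_plus_nonzero[of "a i" "x i" "d i" "g i" "g (Suc i)" "d (Suc i)" "S i" "z i" "x (Suc i)" "y i"]
      next_s[of "a i" "x i" "d i" "g i" "g (Suc i)" "d (Suc i)" "S i" "z i" "x (Suc i)" "y i"]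
    unfolding S_def y_def by blast+
  have tower: "drinfeld_tower (range \<iota>) q \<Theta> w"
  proof (rule drinfeld_tower.intro)
    show "subfield_set (range \<iota>)" by (rule subfield_set_range)
    show "\<Theta> \<in> range \<iota>" "\<Theta> \<noteq> 0" "2 \<le> q" by (auto simp: \<Theta>_def[symmetric] \<Theta>_nonzero q_ge_2) (simp add: \<Theta>_def)
    show "w i \<noteq> 0" "1 + w i \<noteq> 0" for i using y0 one_y \<Theta>_nonzero by (simp_all add: w_def)
    show "\<Theta> ^ (q - 1) * (1 + w (Suc i)) * w i = (1 + w i) ^ q * w (Suc i) ^ q" for i
    proof -
      \<comment> \<open>\<open>Sy\<close> at \<open>Suc i\<close> and \<open>S_Suc\<close> at
        \<open>i\<close> both involve \<open>S (Suc i)\<close>; eliminating it yields the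
        relation.\<close>
      have "\<Theta> ^ (q - 1) * (1 + w (Suc i)) * w i = (\<Theta> ^ (q - 1) * \<Theta>) * (S (Suc i) * y i) * y (Suc i) ^ q"
        unfolding w_def Sy[symmetric] by (simp only: mult_ac)
      also have "S (Suc i) * y i = (1 + w i) ^ q" using S_Suc y0 by (simp add: w_def)
      finally show ?thesis unfolding power_q_pred w_def power_mult_distrib by (simp only: mult_ac)
    qed
  qed
  interpret drinfeld_tower "range \<iota>" q \<Theta> w by (rule tower)
  have "s0 = S 0"
    unfolding s0_def unfolding w_def Sy[symmetric] power_mult_distrib
    using y0[of 0] \<Theta>_nonzero by simp
  hence "j0 = j_invariant \<phi>"
    using src[of 0] by (simp only: j0_def j_invariant_def gd q_card[symmetric])
  moreover have "s n = S (Suc n)" for n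
    unfolding s_def S_Suc unfolding w_def using \<Theta>_nonzero by simp
  hence "j n = j_invariant (\<psi> n)" for n
    using tgt[of "Suc n"] by (simp only: j_def j_invariant_def gd q_card[symmetric])
  ultimately show ?thesis using that tower by blast
qed

end

text \<open>Since \<open>\<xi> i + 1 = - 1 / w i\<close>, this is \<open>rel\<close> in the new
  variable. The hypothesis \<open>minus\<close> covers odd and even \<open>q\<close> alike and gives
  the sign \<open>(- 1) ^ (q - 1) = 1\<close>.\<close>

lemma (in drinfeld_tower) recursion:
  assumes minus: "(- 1 :: 'a) ^ q = - 1"
  defines "\<xi> \<equiv> \<lambda>n. - (1 + w n) / w n"
  shows "\<xi> n + 1 \<noteq> 0"
    and "(\<xi> (Suc n) + 1) ^ (q - 1) * \<xi> (Suc n) = 1 / T ^ (q - 1) * (\<xi> n ^ q / (\<xi> n + 1) ^ (q - 1))"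
proof -
  obtain k where k: "q = Suc k" using q by (cases q) auto
  have m: "(- 1 :: 'a) ^ k = 1" using minus by (simp add: k)
  have \<xi>1: "\<xi> i + 1 = - 1 / w i" for i using w by (simp add: \<xi>_def field_simps)
  show "\<xi> n + 1 \<noteq> 0" using w by (simp add: \<xi>1)
  have pow: "(\<xi> i + 1) ^ k = 1 / w i ^ k" for i
    by (simp only: \<xi>1 power_divide m)
  have l: "(\<xi> (Suc n) + 1) ^ k * \<xi> (Suc n) = - ((1 + w (Suc n)) / w (Suc n) ^ q)"
  proof -
    define N where "N = 1 + w (Suc n)"
    show ?thesis unfolding pow unfolding \<xi>_def N_def[symmetric] by (simp add: k)
  qed
  have "\<xi> n ^ q = (- 1 * ((1 + w n) / w n)) ^ q" by (simp only: \<xi>_def minus_divide_left mult_minus1)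
  hence "\<xi> n ^ q = (- 1) ^ q * ((1 + w n) ^ q / w n ^ q)"
    by (simp only: power_mult_distrib power_divide)
  hence "\<xi> n ^ q / (\<xi> n + 1) ^ k = - ((1 + w n) ^ q / w n)"
    unfolding pow minus using w by (simp add: k)
  moreover have "(1 + w (Suc n)) / w (Suc n) ^ q = 1 / T ^ k * ((1 + w n) ^ q / w n)"
    using rel[of n] w T by (simp add: k field_simps)
  ultimately show "(\<xi> (Suc n) + 1) ^ (q - 1) * \<xi> (Suc n) =
      1 / T ^ (q - 1) * (\<xi> n ^ q / (\<xi> n + 1) ^ (q - 1))"
    using l by (simp add: k)
qed

theorem theorem9:
  fixes \<iota> :: "'q::{field,finite} poly fract \<Rightarrow> 'k::alg_closed_field"
    and \<phi> :: "'q poly \<Rightarrow> 'k poly"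
    and \<psi> :: "nat \<Rightarrow> 'q poly \<Rightarrow> 'k poly"
    and u v :: "nat \<Rightarrow> 'k poly"
    and E :: "nat \<Rightarrow> 'k set"
  assumes embedding: "base_embedding \<iota>"
    and generic: "\<And>n. X0_generic_point \<iota> (T_elem ^ (n + 2)) \<phi> (\<psi> n) (u n)"
    and T_step: "\<And>n. N_isogeny T_elem (\<psi> n) (\<psi> (n + 1)) (v n)"
    and projection: "\<And>n. u (n + 1) = pcompose (v n) (u n)"
    and E: "\<And>n. E n = X0_function_field \<iota> \<phi> (\<psi> n)"
  shows "\<exists>\<xi> :: nat \<Rightarrow> 'k.
           transcendental_over \<iota> (\<xi> 0) \<and>
           E 0 = adjoin (range \<iota>) {\<xi> 0} \<and>
           (\<forall>n. E (n + 1) = adjoin (E n) {\<xi> (n + 1)}) \<and>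
           (\<forall>n. \<xi> n + 1 \<noteq> 0 \<and>
                (\<xi> (n + 1) + 1) ^ (CARD('q) - 1) * \<xi> (n + 1) =
                1 / \<iota> (to_fract T_elem) ^ (CARD('q) - 1) *
                (\<xi> n ^ CARD('q) / (\<xi> n + 1) ^ (CARD('q) - 1)))"
proof -
  interpret isogeny_tower \<iota> "CARD('q)" \<phi> \<psi> u v
    using embedding generic T_step projection by unfold_locales (auto simp: X0_generic_point_def)
  obtain w where tower: "drinfeld_tower (range \<iota>) CARD('q) \<Theta> w"
    and j0: "drinfeld_tower.j0 CARD('q) \<Theta> w = j_invariant \<phi>"
    and j: "\<And>n. drinfeld_tower.j CARD('q) \<Theta> w n = j_invariant (\<psi> n)"
    using tower_parameters by blast
  interpret tower: drinfeld_tower "range \<iota>" "CARD('q)" \<Theta> w by (rule tower)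
  interpret tower: generic_drinfeld_tower "range \<iota>" "CARD('q)" \<Theta> w
  proof
    fix p assume p: "p \<in> poly_over (range \<iota>)" "poly p tower.j0 = 0"
    have "ring.transcendental type_ring (range \<iota>) tower.j0"
      using generic[of 0] by (simp add: j0 X0_generic_point_def transcendental_over_def)
    thus "p = 0" using p transcendental_type_ring_iff[OF subfield_set_range] by blast
  qed
  have EK: "E n = tower.K n" for n
    using tower.adjoin_j[of n] by (simp add: E X0_function_field_def j0 j)
  define \<xi> where "\<xi> = (\<lambda>n. - (1 + w n) / w n)"
  have adj: "adjoin L {w n} = adjoin L {\<xi> n}" for L n
    unfolding \<xi>_def by (rule adjoin_moebius[OF tower.w(1)])
  \<comment> \<open>The transcendental \<open>w 0\<close> lies in the field generated by
    \<open>\<xi> 0\<close>, so \<open>\<xi> 0\<close> is transcendental as well.\<close>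
  have "w 0 \<in> adjoin (range \<iota>) {\<xi> 0}"
    using adjoin_incl[of "range \<iota>" "{w 0}"] by (auto simp: adj[symmetric])
  hence "transcendental_over \<iota> (\<xi> 0)"
    unfolding transcendental_over_def transcendental_type_ring_iff[OF subfield_set_range]
    using transcendental_of_mem_adjoin[OF subfield_set_range tower.w0_transcendental] by blast
  moreover have "E 0 = adjoin (range \<iota>) {\<xi> 0}"
    unfolding EK tower.K_0 adj ..
  moreover have "E (n + 1) = adjoin (E n) {\<xi> (n + 1)}" for n
    by (simp add: EK adj)
  moreover have "\<xi> n + 1 \<noteq> 0 \<and> (\<xi> (n + 1) + 1) ^ (CARD('q) - 1) * \<xi> (n + 1) =
      1 / \<iota> (to_fract T_elem) ^ (CARD('q) - 1) * (\<xi> n ^ CARD('q) / (\<xi> n + 1) ^ (CARD('q) - 1))" for n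
    using tower.recursion[of n] minus_power_card[of 1] unfolding \<xi>_def \<Theta>_def by simp
  ultimately show ?thesis by blast
qed

end
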